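(* Let $X$ be a reflexive and separable Banach space. A quasiconvex function $f:X\to\mathbb{R}$ is densely continuous if and only if the set of points of discontinuity of $f$ is Haar null.
   Context: Banach spaces are real. A function $f:X\to\mathbb{R}$ is quasiconvex if $f(\lambda x+(1-\lambda)y)\le\max\{f(x),f(y)\}$ for all $x,y\in X$ and $\lambda\in[0,1]$. It is densely continuous if it is continuous at the points of a dense subset of $X$. A Borel set $E\subset X$ is Haar null if there is a Borel probability measure $\mu$ on $X$ with $\mu(x+E)=0$ for every $x\in X$. *)

theory Defs
  imports "HOL-Probability.Probability"
begin

text \<open>
  The topological dual of \<open>'a\<close> is the normed space \<open>'a \<Rightarrow>\<^sub>L real\<close> of bounded linear functionals.
  Reflexivity says that the canonical embedding into the bidual, sending \<open>x\<close> to evaluation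
  at \<open>x\<close>, is onto.
\<close>
definition reflexive_space :: "'a::real_normed_vector itself \<Rightarrow> bool" where
  "reflexive_space (_ :: 'a itself) \<longleftrightarrow>
     (\<forall>\<Phi> :: ('a \<Rightarrow>\<^sub>L real) \<Rightarrow>\<^sub>L real. \<exists>x::'a. \<forall>\<phi> :: 'a \<Rightarrow>\<^sub>L real.
        blinfun_apply \<Phi> \<phi> = blinfun_apply \<phi> x)"

definition quasiconvex :: "('a::real_vector \<Rightarrow> real) \<Rightarrow> bool" where
  "quasiconvex f \<longleftrightarrow>
     (\<forall>x y. \<forall>t\<in>{0..1}. f (t *\<^sub>R x + (1 - t) *\<^sub>R y) \<le> max (f x) (f y))"

definition densely_continuous :: "('a::t2_space \<Rightarrow> 'b::topological_space) \<Rightarrow> bool" where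
  "densely_continuous f \<longleftrightarrow>
     (\<exists>D. closure D = UNIV \<and> (\<forall>x\<in>D. isCont f x))"

definition haar_null :: "'a::real_normed_vector set \<Rightarrow> bool" where
  "haar_null E \<longleftrightarrow> E \<in> sets borel \<and>
     (\<exists>\<mu> :: 'a measure. prob_space \<mu> \<and> sets \<mu> = sets borel \<and>
        (\<forall>x. emeasure \<mu> ((\<lambda>e. x + e) ` E) = 0))"

end

theory Submission
  imports Defs
begin

text \<open>
  A set with non-empty interior is not Haar null in a separable space, so a Haar null set of
  discontinuities has dense complement. This is the easy direction.

  Conversely, let \<open>f\<close> be quasiconvex and densely continuous. Its sublevel sets are convex, and a
  discontinuity lies either on the boundary of a set \<open>{f < q}\<close> with non-empty interior or in the
  closure of a set \<open>{f \<le> q}\<close>, this closure having empty interior, with \<open>q\<close> rational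
  (\<open>discontinuity_near_sublevels\<close>). It remains to see that these countably many sets are Haar null, by
  one measure for all of them. To this end Haar nullness is reduced to a finitary property, being
  \<open>thin\<close>: for all \<open>\<epsilon>\<close> and \<open>\<delta>\<close> some finitely supported probability measure on the \<open>\<epsilon>\<close>-ball gives
  mass at most \<open>\<delta>\<close> to every translate of the set. Convolving infinitely many such measures yields a
  single measure that is null on all translates of countably many thin Borel sets
  (\<open>haar_null_if_covered_by_thin\<close>).

  A boundary of a convex set with interior is a countable union of pieces that meet each line in a
  suitable direction at most once, and such pieces are thin (\<open>thin_frontier_seen_along\<close>).

  The heart of the matter is that in a separable reflexive space a bounded closed convex set \<open>C\<close> with
  empty interior is thin (\<open>thin_bounded_convex_empty_interior\<close>). One constructs a sequence in the
  \<open>\<epsilon>\<close>-ball no infinite subsequence of which has a translate inside \<open>C\<close>. If \<open>C\<close> were not thin, all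
  convex means of this sequence would charge some translate of \<open>C\<close> by more than a fixed \<open>\<delta>\<close>. Ptak's
  combinatorial lemma (\<open>ptak_infinite_sequence\<close>) then extracts a subsequence each of whose finite parts can
  be translated into \<open>C\<close>, and reflexivity, through the non-empty intersection of decreasing
  bounded closed convex sets (\<open>reflexive_decreasing_convex_Inter\<close>), makes one translation work for
  the whole subsequence, a contradiction. The sequence exists because a closed convex set that covers a
  ball up to a finite-dimensional set and half the radius, and is not contained in a translate of a proper
  subspace, has interior points by Baire's theorem (\<open>interior_nonempty_if_finite_enlargement\<close>).
\<close>

section \<open>Sublinear functionals and Hahn-Banach\<close>

definition sublinear :: "('v::real_vector \<Rightarrow> real) \<Rightarrow> bool" where
  "sublinear p \<longleftrightarrow> (\<forall>u v. p (u + v) \<le> p u + p v) \<and> (\<forall>c u. 0 < c \<longrightarrow> p (c *\<^sub>R u) = c * p u)"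

lemma sublinear_zero:
  assumes "sublinear p" shows "p 0 = 0"
proof -
  have "p ((2::real) *\<^sub>R 0) = 2 * p 0"
    using assms unfolding sublinear_def by (meson zero_less_numeral)
  then show ?thesis by simp
qed

lemma sublinear_ge_minus:
  assumes "sublinear p" shows "- p (- v) \<le> p v"
proof -
  have "p (v + - v) \<le> p v + p (- v)"
    using assms unfolding sublinear_def by blast
  then show ?thesis using sublinear_zero[OF assms] by simp
qed

text \<open>
  A family may consist of functions that are far from sublinear, such as shifted norms: it suffices
  that sums and positive multiples of values are dominated by values of further members.
\<close>
lemma sublinear_INF:
  assumes ne: "I \<noteq> {}" and bdd: "\<And>v. bdd_below ((\<lambda>i. f i v) ` I)"
    and add: "\<And>i j u v. i \<in> I \<Longrightarrow> j \<in> I \<Longrightarrow> \<exists>k\<in>I. f k (u + v) \<le> f i u + f j v"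
    and scale: "\<And>i c u. i \<in> I \<Longrightarrow> 0 < c \<Longrightarrow> \<exists>k\<in>I. f k (c *\<^sub>R u) \<le> c * f i u"
  shows "sublinear (\<lambda>v. INF i\<in>I. f i v)"
proof -
  let ?p = "\<lambda>v. INF i\<in>I. f i v"
  have lower: "?p v \<le> f i v" if "i \<in> I" for i v
    using bdd that by (rule cINF_lower)
  have sub: "?p (u + v) \<le> ?p u + ?p v" for u v
  proof -
    have "?p (u + v) - f j v \<le> ?p u" if "j \<in> I" for j
    proof (rule cINF_greatest[OF ne])
      fix i assume "i \<in> I"
      then obtain k where "k \<in> I" "f k (u + v) \<le> f i u + f j v" using add \<open>j \<in> I\<close> by blast
      then show "?p (u + v) - f j v \<le> f i u" using lower[of k "u + v"] by linarith
    qed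
    then have "?p (u + v) - ?p u \<le> f j v" if "j \<in> I" for j using that by force
    then have "?p (u + v) - ?p u \<le> ?p v" by (rule cINF_greatest[OF ne])
    then show ?thesis by linarith
  qed
  have le: "?p (c *\<^sub>R u) \<le> c * ?p u" if c: "0 < c" for c u
  proof -
    have "?p (c *\<^sub>R u) / c \<le> f i u" if i: "i \<in> I" for i
    proof -
      obtain k where "k \<in> I" "f k (c *\<^sub>R u) \<le> c * f i u" using scale[OF i c] by blast
      then have "?p (c *\<^sub>R u) \<le> c * f i u" using lower[of k "c *\<^sub>R u"] by linarith
      then show ?thesis using c by (simp add: field_simps)
    qed
    then have "?p (c *\<^sub>R u) / c \<le> ?p u" by (rule cINF_greatest[OF ne])
    then show ?thesis using c by (simp add: field_simps)
  qed
  have "?p (c *\<^sub>R u) = c * ?p u" if c: "0 < c" for c u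
  proof -
    have "?p (inverse c *\<^sub>R (c *\<^sub>R u)) \<le> inverse c * ?p (c *\<^sub>R u)"
      using le[of "inverse c" "c *\<^sub>R u"] c by simp
    then have "c * ?p u \<le> ?p (c *\<^sub>R u)" using c by (simp add: field_simps)
    then show ?thesis using le[OF c, of u] by simp
  qed
  then show ?thesis unfolding sublinear_def using sub by blast
qed

text \<open>
  Pushing \<open>q\<close> down along a direction \<open>v\<close>, that is, passing to
  \<open>INF t \<ge> 0. q (y + t v) - t q v\<close>, gives another sublinear functional below \<open>q\<close>. If \<open>q\<close> is minimal,
  this changes nothing, and \<open>t = 1\<close> yields the missing superadditivity.
\<close>
lemma minimal_sublinear_imp_linear:
  assumes q: "sublinear q"
    and min: "\<And>r. sublinear r \<Longrightarrow> (\<And>v. r v \<le> q v) \<Longrightarrow> r = q"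
  shows "linear q"
proof -
  have qadd: "q (a + b) \<le> q a + q b" for a b using q unfolding sublinear_def by blast
  have qscale: "q (c *\<^sub>R a) = c * q a" if "0 \<le> c" for a c
    using q that sublinear_zero[OF q] unfolding sublinear_def by (cases "c = 0") auto
  have super: "q x + q v \<le> q (x + v)" for x v
  proof -
    let ?r = "\<lambda>t y. q (y + t *\<^sub>R v) - t * q v"
    let ?p = "\<lambda>y. INF t\<in>{0..}. ?r t y"
    have bdd: "bdd_below ((\<lambda>t. ?r t y) ` {0..})" for y
    proof (rule bdd_belowI2[of _ "- q (- y)"])
      fix t :: real assume t: "t \<in> {0..}"
      have "q (t *\<^sub>R v) \<le> q (y + t *\<^sub>R v) + q (- y)" using qadd[of "y + t *\<^sub>R v" "- y"] by simp
      then show "- q (- y) \<le> ?r t y" using t qscale[of t v] by simp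
    qed
    have "sublinear ?p"
    proof (rule sublinear_INF[OF _ bdd])
      fix t t' :: real and y z assume t: "t \<in> {0..}" "t' \<in> {0..}"
      have "q (y + z + (t + t') *\<^sub>R v) \<le> q (y + t *\<^sub>R v) + q (z + t' *\<^sub>R v)"
        using qadd[of "y + t *\<^sub>R v" "z + t' *\<^sub>R v"] by (simp add: algebra_simps)
      then have "?r (t + t') (y + z) \<le> ?r t y + ?r t' z" by (simp add: algebra_simps)
      then show "\<exists>k\<in>{0..}. ?r k (y + z) \<le> ?r t y + ?r t' z"
        using t by (intro bexI[of _ "t + t'"]) auto
    next
      fix t c :: real and y assume t: "t \<in> {0..}" and c: "0 < c"
      have "?r (c * t) (c *\<^sub>R y) \<le> c * ?r t y"
        using qscale[of c "y + t *\<^sub>R v"] c by (simp add: algebra_simps)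
      then show "\<exists>k\<in>{0..}. ?r k (c *\<^sub>R y) \<le> c * ?r t y"
        using t c by (intro bexI[of _ "c * t"]) auto
    qed auto
    moreover have "?p y \<le> q y" for y
      using cINF_lower[OF bdd, of 0 y] by simp
    ultimately have eq: "?p = q" by (rule min)
    have "?p x \<le> ?r 1 x" using cINF_lower[OF bdd, of 1 x] by simp
    then show ?thesis unfolding fun_cong[OF eq, of x] by simp
  qed
  have add: "q (a + b) = q a + q b" for a b using qadd super by (simp add: antisym)
  have neg: "q (- a) = - q a" for a using add[of a "- a"] sublinear_zero[OF q] by simp
  have "q (c *\<^sub>R a) = c * q a" for c a
    using qscale[of c a] qscale[of "- c" a] neg[of "c *\<^sub>R a"] by (cases "0 \<le> c") auto
  then show ?thesis using add by (intro linearI) auto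
qed

text \<open>
  Hahn-Banach in the form that is used both on the space and on its dual. By Zorn's lemma there is
  a minimal sublinear functional below \<open>p\<close>: the pointwise infimum of a chain stays finite because
  each member \<open>q\<close> satisfies \<open>q v \<ge> - q (- v) \<ge> - p (- v)\<close>.
\<close>
theorem sublinear_dominates_linear:
  assumes p: "sublinear p"
  obtains l where "linear l" "\<And>v. l v \<le> p v"
proof -
  let ?A = "{q. sublinear q \<and> (\<forall>v. q v \<le> p v)}"
  let ?P = "\<lambda>q r. r \<le> (q :: 'a \<Rightarrow> real)"
  have "\<exists>m\<in>?A. \<forall>q\<in>?A. ?P m q \<longrightarrow> q = m"
  proof (rule predicate_Zorn)
    show "partial_order_on ?A (relation_of ?P ?A)"
      by (auto simp: partial_order_on_def preorder_on_def relation_of_def refl_on_def trans_def antisym_def)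
  next
    fix C assume C: "C \<in> Chains (relation_of ?P ?A)"
    have lin: "q \<le> r \<or> r \<le> q" if "q \<in> C" "r \<in> C" for q r
      using C that unfolding Chains_def relation_of_def by auto
    show "\<exists>u\<in>?A. \<forall>a\<in>C. ?P a u"
    proof (cases "C = {}")
      case True
      then show ?thesis using p by auto
    next
      case False
      have CA: "C \<subseteq> ?A" using C unfolding Chains_def relation_of_def by auto
      have bdd: "bdd_below ((\<lambda>q. q v) ` C)" for v
      proof (rule bdd_belowI)
        fix x assume "x \<in> (\<lambda>q. q v) ` C"
        then obtain q where q: "q \<in> C" "x = q v" by auto
        with CA have "sublinear q" "q (- v) \<le> p (- v)" by auto
        then show "- p (- v) \<le> x" using sublinear_ge_minus[of q v] q by simp
      qed
      have "sublinear (\<lambda>v. INF q\<in>C. q v)"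
      proof (rule sublinear_INF[OF False bdd])
        fix q r u v assume qr: "q \<in> C" "r \<in> C"
        then have s: "sublinear q" "sublinear r" using CA by auto
        show "\<exists>s\<in>C. s (u + v) \<le> q u + r v"
        proof (cases "q \<le> r")
          case True
          then have "q (u + v) \<le> q u + r v" using s(1) unfolding sublinear_def le_fun_def
            by (meson add_left_mono order_trans)
          then show ?thesis using qr by blast
        next
          case False
          then have "r \<le> q" using lin qr by blast
          then have "r (u + v) \<le> q u + r v" using s(2) unfolding sublinear_def le_fun_def
            by (meson add_right_mono order_trans)
          then show ?thesis using qr by blast
        qed
      next
        fix q and c :: real and u assume "q \<in> C" "0 < c"
        moreover from this have "sublinear q" using CA by auto
        ultimately show "\<exists>s\<in>C. s (c *\<^sub>R u) \<le> c * q u" unfolding sublinear_def by (metis order_refl)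
      qed
      moreover have low: "(INF q\<in>C. q v) \<le> q v" if "q \<in> C" for q v
        using bdd that by (rule cINF_lower)
      moreover have "(INF q\<in>C. q v) \<le> p v" for v
        using False CA low by (metis (mono_tags, lifting) all_not_in_conv mem_Collect_eq order_trans subset_iff)
      ultimately show ?thesis by (intro bexI[of _ "\<lambda>v. INF q\<in>C. q v"]) (auto simp: le_fun_def)
    qed
  qed
  then obtain m where m: "sublinear m" "\<And>v. m v \<le> p v"
    and min: "\<And>q. q \<in> ?A \<Longrightarrow> q \<le> m \<Longrightarrow> q = m" by blast
  have "linear m"
  proof (rule minimal_sublinear_imp_linear[OF m(1)])
    fix r assume "sublinear r" and r: "\<And>v. r v \<le> m v"
    moreover have "r v \<le> p v" for v using r[of v] m(2)[of v] by simp
    ultimately show "r = m" by (intro min) (auto simp: le_fun_def)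
  qed
  then show ?thesis using m(2) that by blast
qed

section \<open>Decreasing convex sets in a reflexive space\<close>

text \<open>
  With \<open>d\<close> at most the distance from \<open>x\<close> to \<open>D\<close>, the functional
  \<open>p v = INF t \<ge> 0, a \<in> D. norm (v + t (a - x)) - t d\<close> is sublinear, convexity of \<open>D\<close> giving
  subadditivity. It is below the norm (\<open>t = 0\<close>) and at most \<open>- d\<close> at \<open>x - a\<close> (\<open>t = 1\<close>), so any linear
  functional below it is bounded and separates.
\<close>
lemma separate_point_closed_convex:
  fixes D :: "'a::real_normed_vector set"
  assumes D: "closed D" "convex D" "D \<noteq> {}" and x: "x \<notin> D"
  obtains \<phi> :: "'a \<Rightarrow>\<^sub>L real" and d where "0 < d" "\<And>a. a \<in> D \<Longrightarrow> \<phi> x + d \<le> \<phi> a"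
proof -
  obtain d where d: "0 < d" and dist: "\<And>a. a \<in> D \<Longrightarrow> d \<le> norm (a - x)"
  proof -
    have "open (- D)" "x \<in> - D" using D x by auto
    then obtain e where "0 < e" "ball x e \<subseteq> - D" using open_contains_ball by blast
    then have "e \<le> norm (a - x)" if "a \<in> D" for a
      using that by (force simp: ball_def dist_norm norm_minus_commute not_le)
    with \<open>0 < e\<close> that show ?thesis by blast
  qed
  let ?r = "\<lambda>t a v. norm (v + t *\<^sub>R (a - x)) - t * d"
  let ?I = "{0::real..} \<times> D"
  let ?p = "\<lambda>v. INF (t, a)\<in>?I. ?r t a v"
  obtain a0 where a0: "a0 \<in> D" using D by auto
  have bdd: "bdd_below ((\<lambda>(t, a). ?r t a v) ` ?I)" for v
  proof (rule bdd_belowI2[of _ "- norm v"])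
    fix i assume "i \<in> ?I"
    then obtain t :: real and a where t: "0 \<le> t" "a \<in> D" "i = (t, a)" by auto
    have "norm (t *\<^sub>R (a - x)) \<le> norm (v + t *\<^sub>R (a - x)) + norm v"
      using norm_triangle_ineq4[of "v + t *\<^sub>R (a - x)" v] by simp
    moreover have "t * d \<le> norm (t *\<^sub>R (a - x))" using t dist by (simp add: mult_left_mono)
    ultimately show "- norm v \<le> (case i of (t, a) \<Rightarrow> ?r t a v)" using t by simp
  qed
  have "sublinear (\<lambda>v. INF i\<in>?I. (case i of (t, a) \<Rightarrow> \<lambda>v. ?r t a v) v)"
  proof (rule sublinear_INF)
    show "?I \<noteq> {}" using a0 by blast
    show "bdd_below ((\<lambda>i. (case i of (t, a) \<Rightarrow> \<lambda>v. ?r t a v) v) ` ?I)" for v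
      using bdd[of v] by (simp add: case_prod_unfold)
  next
    fix i j y z assume "i \<in> ?I" "j \<in> ?I"
    then obtain t a t' a' where t: "0 \<le> t" "a \<in> D" "i = (t, a)" "0 \<le> t'" "a' \<in> D" "j = (t', a')"
      by auto
    have "\<exists>(s, b)\<in>?I. ?r s b (y + z) \<le> ?r t a y + ?r t' a' z"
    proof (cases "t + t' = 0")
      case True
      then have "t = 0" "t' = 0" using t by auto
      then have "?r 0 a (y + z) \<le> ?r t a y + ?r t' a' z" using norm_triangle_ineq[of y z] by simp
      then show ?thesis using t by (intro bexI[of _ "(0, a)"]) auto
    next
      case False
      \<comment> \<open>the convex combination that merges the two rays into one\<close>
      define b where "b = (t / (t + t')) *\<^sub>R a + (t' / (t + t')) *\<^sub>R a'"
      have "b \<in> D" unfolding b_def using D(2) t False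
        by (intro convexD) (auto simp: add_divide_distrib[symmetric])
      have "(t + t') *\<^sub>R b = t *\<^sub>R a + t' *\<^sub>R a'" unfolding b_def using False by (simp add: scaleR_add_right)
      then have eq: "(t + t') *\<^sub>R (b - x) = t *\<^sub>R (a - x) + t' *\<^sub>R (a' - x)" by (simp add: algebra_simps)
      have "y + z + (t + t') *\<^sub>R (b - x) = (y + t *\<^sub>R (a - x)) + (z + t' *\<^sub>R (a' - x))"
        unfolding eq by simp
      then have "norm (y + z + (t + t') *\<^sub>R (b - x)) \<le> norm (y + t *\<^sub>R (a - x)) + norm (z + t' *\<^sub>R (a' - x))"
        using norm_triangle_ineq by metis
      then have "?r (t + t') b (y + z) \<le> ?r t a y + ?r t' a' z" by (simp add: algebra_simps)
      then show ?thesis using t \<open>b \<in> D\<close> by (intro bexI[of _ "(t + t', b)"]) auto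
    qed
    then show "\<exists>k\<in>?I. (case k of (t, a) \<Rightarrow> \<lambda>v. ?r t a v) (y + z)
        \<le> (case i of (t, a) \<Rightarrow> \<lambda>v. ?r t a v) y + (case j of (t, a) \<Rightarrow> \<lambda>v. ?r t a v) z"
      unfolding t by auto
  next
    fix i y and c :: real assume "i \<in> ?I" and c: "0 < c"
    then obtain t a where t: "0 \<le> t" "a \<in> D" "i = (t, a)" by auto
    have "norm (c *\<^sub>R (y + t *\<^sub>R (a - x))) = c * norm (y + t *\<^sub>R (a - x))" using c by simp
    then have "?r (c * t) a (c *\<^sub>R y) \<le> c * ?r t a y" by (simp add: algebra_simps)
    then show "\<exists>k\<in>?I. (case k of (t, a) \<Rightarrow> \<lambda>v. ?r t a v) (c *\<^sub>R y)
        \<le> c * (case i of (t, a) \<Rightarrow> \<lambda>v. ?r t a v) y"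
      using t c by (intro bexI[of _ "(c * t, a)"]) auto
  qed
  then have "sublinear ?p" by (simp add: case_prod_unfold)
  from sublinear_dominates_linear[OF this]
  obtain l where l: "linear l" and lp: "\<And>v. l v \<le> ?p v" by blast
  have p_le: "l v \<le> ?r t a v" if "0 \<le> t" "a \<in> D" for t a v
    using cINF_lower[OF bdd, of "(t, a)" v] that lp[of v] by simp
  have ln: "l v \<le> norm v" for v using p_le[OF order_refl a0] by simp
  have "\<bar>l v\<bar> \<le> norm v" for v using ln[of v] ln[of "- v"] linear_neg[OF l] by simp
  then have bl: "bounded_linear l" using l
    by (intro linear_conv_bounded_linear[THEN iffD1] bounded_linear.intro bounded_linear_axioms.intro)
      (auto intro: exI[of _ 1])
  have "l (x - a) \<le> - d" if "a \<in> D" for a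
    using p_le[of 1 a "x - a"] that by simp
  then have "l x + d \<le> l a" if "a \<in> D" for a
    using that linear_diff[OF l, of x a] by fastforce
  then show ?thesis using that[of d "Blinfun l"] bl d by (simp add: bounded_linear_Blinfun_apply)
qed

text \<open>
  Reflexivity enters the proof here, in place of weak compactness of balls. On the dual,
  \<open>p \<phi> = INF n. SUP a \<in> D n. \<phi> a\<close> is sublinear and bounded by a multiple of
  the norm. A linear functional below \<open>p\<close> is evaluation at some \<open>x\<close>, and separating \<open>x\<close> from
  some \<open>D n\<close> by \<open>\<phi>\<close> would violate the bound by \<open>p\<close> at \<open>- \<phi>\<close>.
\<close>
theorem reflexive_decreasing_convex_Inter:
  fixes D :: "nat \<Rightarrow> 'a::real_normed_vector set"
  assumes refl: "reflexive_space TYPE('a)"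
    and D: "\<And>n. closed (D n)" "\<And>n. convex (D n)" "\<And>n. D n \<noteq> {}" "bounded (D 0)" "decseq D"
  shows "(\<Inter>n. D n) \<noteq> {}"
proof -
  obtain M where M: "\<And>a. a \<in> D 0 \<Longrightarrow> norm a \<le> M" using D(4) unfolding bounded_iff by blast
  have DM: "norm a \<le> M" if "a \<in> D n" for a n using M that decseqD[OF D(5), of 0 n] by auto
  have app: "\<bar>blinfun_apply \<phi> a\<bar> \<le> norm \<phi> * M" if "a \<in> D n" for \<phi> :: "'a \<Rightarrow>\<^sub>L real" and a n
    using norm_blinfun[of \<phi> a] mult_left_mono[OF DM[OF that], of "norm \<phi>"] by simp
  have up: "blinfun_apply \<phi> a \<le> norm \<phi> * M" if "a \<in> D n" for \<phi> :: "'a \<Rightarrow>\<^sub>L real" and a n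
    using app[OF that, of \<phi>] by linarith
  have bdda: "bdd_above (blinfun_apply \<phi> ` D n)" for \<phi> :: "'a \<Rightarrow>\<^sub>L real" and n
    using up by (rule bdd_aboveI2)
  let ?s = "\<lambda>n (\<phi> :: 'a \<Rightarrow>\<^sub>L real). SUP a\<in>D n. blinfun_apply \<phi> a"
  let ?p = "\<lambda>\<phi>. INF n. ?s n \<phi>"
  have upper: "blinfun_apply \<phi> a \<le> ?s n \<phi>" if "a \<in> D n" for \<phi> a n
    using that bdda by (rule cSUP_upper)
  have lowbd: "- (norm \<phi> * M) \<le> ?s n \<phi>" for \<phi> n
  proof -
    obtain a where "a \<in> D n" using D(3) by blast
    then show ?thesis using upper[of a n \<phi>] app[of a n \<phi>] by linarith
  qed
  have bdd: "bdd_below (range (\<lambda>n. ?s n \<phi>))" for \<phi>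
    by (rule bdd_belowI[of _ "- (norm \<phi> * M)"]) (use lowbd in auto)
  have "sublinear ?p"
  proof (rule sublinear_INF[OF _ bdd])
    fix m n \<phi> \<psi>
    have "?s (max m n) (\<phi> + \<psi>) \<le> ?s m \<phi> + ?s n \<psi>"
    proof (rule cSUP_least[OF D(3)])
      fix a assume "a \<in> D (max m n)"
      then have "a \<in> D m" "a \<in> D n"
        using decseqD[OF D(5), of m "max m n"] decseqD[OF D(5), of n "max m n"] by auto
      then show "blinfun_apply (\<phi> + \<psi>) a \<le> ?s m \<phi> + ?s n \<psi>"
        using upper[of a m \<phi>] upper[of a n \<psi>] by (simp add: blinfun.add_left)
    qed
    then show "\<exists>k\<in>UNIV. ?s k (\<phi> + \<psi>) \<le> ?s m \<phi> + ?s n \<psi>" by blast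
  next
    fix m \<phi> and c :: real assume c: "0 < c"
    have "?s m (c *\<^sub>R \<phi>) \<le> c * ?s m \<phi>"
      by (rule cSUP_least[OF D(3)]) (use upper c in \<open>simp add: blinfun.scaleR_left\<close>)
    then show "\<exists>k\<in>UNIV. ?s k (c *\<^sub>R \<phi>) \<le> c * ?s m \<phi>" by blast
  qed auto
  from sublinear_dominates_linear[OF this]
  obtain \<Phi> where lin: "linear \<Phi>" and le: "\<And>\<phi>. \<Phi> \<phi> \<le> ?p \<phi>" by blast
  have le_s: "\<Phi> \<phi> \<le> ?s n \<phi>" for \<phi> n
  proof -
    have "?p \<phi> \<le> ?s n \<phi>" using cINF_lower[OF bdd, of n \<phi>] by simp
    then show ?thesis using le[of \<phi>] by linarith
  qed
  have "\<Phi> \<phi> \<le> norm \<phi> * M" for \<phi>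
  proof -
    have "?s 0 \<phi> \<le> norm \<phi> * M"
      by (rule cSUP_least[OF D(3)]) (rule up)
    then show ?thesis using le_s[of \<phi> 0] by simp
  qed
  then have "\<bar>\<Phi> \<phi>\<bar> \<le> norm \<phi> * M" for \<phi>
    using linear_neg[OF lin, of \<phi>] by (metis abs_le_iff norm_minus_cancel)
  then have bl: "bounded_linear \<Phi>"
    using lin by (intro linear_conv_bounded_linear[THEN iffD1] bounded_linear.intro
        bounded_linear_axioms.intro) (auto intro: exI[of _ M])
  obtain x where x: "\<And>\<phi> :: 'a \<Rightarrow>\<^sub>L real. \<Phi> \<phi> = blinfun_apply \<phi> x"
    using refl bl unfolding reflexive_space_def by (metis bounded_linear_Blinfun_apply)
  have "x \<in> D n" for n
  proof (rule ccontr)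
    assume "x \<notin> D n"
    then obtain \<phi> :: "'a \<Rightarrow>\<^sub>L real" and d
      where d: "0 < d" "\<And>a. a \<in> D n \<Longrightarrow> \<phi> x + d \<le> \<phi> a"
      using separate_point_closed_convex[OF D(1,2,3)] by metis
    have "?s n (- \<phi>) \<le> - (\<phi> x + d)"
      by (rule cSUP_least[OF D(3)]) (use d in \<open>fastforce simp: blinfun.minus_left\<close>)
    then show False using le_s[of "- \<phi>" n] x[of "- \<phi>"] d(1) by (simp add: blinfun.minus_left)
  qed
  then show ?thesis by blast
qed

section \<open>Ptak's lemma on convex means\<close>

text \<open>
  The finitely supported probability measures on the natural numbers act as the convex means of
  Ptak's lemma. A sequence of means escapes if the supports leave every initial segment.
\<close>
definition escaping :: "(nat \<Rightarrow> nat pmf) \<Rightarrow> bool" where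
  "escaping q \<longleftrightarrow> (\<forall>j. finite (set_pmf (q j))) \<and> (\<forall>n. \<exists>J. \<forall>j\<ge>J. set_pmf (q j) \<subseteq> {n..})"

text \<open>
  Read \<open>R x k\<close> as ``\<open>x\<close> hits \<open>k\<close>''. A set of points is negligible if every escaping sequence of means
  has convex combinations (\<open>bind_pmf t q\<close> is the combination with weights \<open>t\<close>) giving uniformly small
  mass to what a point of the set hits. Asking this for all escaping sequences, and not only for point
  masses, is what makes negligibility pass to finite unions.
\<close>
definition negligible_for :: "('x \<Rightarrow> nat \<Rightarrow> bool) \<Rightarrow> 'x set \<Rightarrow> bool" where
  "negligible_for R A \<longleftrightarrow> (\<forall>q \<delta>. escaping q \<longrightarrow> 0 < \<delta> \<longrightarrow>
     (\<exists>t. finite (set_pmf t) \<and> (\<forall>x\<in>A. measure_pmf.prob (bind_pmf t q) {k. R x k} \<le> \<delta>)))"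

lemma negligible_forD:
  assumes "negligible_for R A" "escaping q" "0 < \<delta>"
  shows "\<exists>t. finite (set_pmf t) \<and> (\<forall>x\<in>A. measure_pmf.prob (bind_pmf t q) {k. R x k} \<le> \<delta>)"
  using assms unfolding negligible_for_def by blast

lemma escaping_shift: "escaping q \<Longrightarrow> escaping (\<lambda>j. q (j + n))"
  unfolding escaping_def by (meson trans_le_add1)

lemma prob_bind_pmf_le:
  fixes t :: "'i pmf"
  assumes "\<And>j. j \<in> set_pmf t \<Longrightarrow> measure_pmf.prob (q j) S \<le> \<delta>" "0 \<le> \<delta>"
  shows "measure_pmf.prob (bind_pmf t q) S \<le> \<delta>"
proof -
  have "emeasure (bind_pmf t q) S = (\<integral>\<^sup>+ j. emeasure (q j) S \<partial>measure_pmf t)"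
    by simp
  also have "\<dots> \<le> (\<integral>\<^sup>+ j. ennreal \<delta> \<partial>measure_pmf t)"
    by (intro nn_integral_mono_AE)
      (auto simp: AE_measure_pmf_iff measure_pmf.emeasure_eq_measure assms)
  also have "\<dots> = ennreal \<delta>" by (simp add: measure_pmf.emeasure_space_1)
  finally show ?thesis using assms(2) by (simp add: measure_pmf.emeasure_eq_measure)
qed

lemma prob_bernoulli_mixture:
  assumes "0 \<le> c" "c \<le> 1"
  shows "measure_pmf.prob (bind_pmf (bernoulli_pmf c) (\<lambda>b. if b then p else q)) S
    = c * measure_pmf.prob p S + (1 - c) * measure_pmf.prob q S"
proof -
  have "emeasure (bind_pmf (bernoulli_pmf c) (\<lambda>b. if b then p else q)) S
    = (\<integral>\<^sup>+ b. emeasure (if b then p else q) S \<partial>measure_pmf (bernoulli_pmf c))"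
    by simp
  also have "\<dots> = ennreal (c * measure_pmf.prob p S + (1 - c) * measure_pmf.prob q S)"
    using assms by (simp add: measure_pmf.emeasure_eq_measure ennreal_mult'[symmetric]
        ennreal_plus[symmetric] mult.commute del: ennreal_plus)
  finally show ?thesis using assms
    by (simp add: measure_pmf.emeasure_eq_measure del: ennreal_plus)
qed

text \<open>
  First combine the tails of \<open>q\<close> into an escaping sequence of means that is uniformly small on \<open>A\<close>, then
  combine that sequence into a mean that is small on \<open>B\<close>. Averaging does not spoil the bound on \<open>A\<close>.
\<close>
lemma negligible_for_Un:
  assumes A: "negligible_for R A" and B: "negligible_for R B"
  shows "negligible_for R (A \<union> B)"
  unfolding negligible_for_def
proof (intro allI impI)
  fix q and \<delta> :: real assume q: "escaping q" and \<delta>: "0 < \<delta>"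
  have "\<exists>t. finite (set_pmf t) \<and>
      (\<forall>x\<in>A. measure_pmf.prob (bind_pmf t (\<lambda>j. q (j + n))) {k. R x k} \<le> \<delta>)" for n
    by (rule negligible_forD[OF A escaping_shift[OF q] \<delta>])
  then obtain t where t: "\<And>n. finite (set_pmf (t n))"
    and tA: "\<And>n x. x \<in> A \<Longrightarrow> measure_pmf.prob (bind_pmf (t n) (\<lambda>j. q (j + n))) {k. R x k} \<le> \<delta>"
    by metis
  let ?r = "\<lambda>n. bind_pmf (t n) (\<lambda>j. q (j + n))"
  have "escaping ?r" unfolding escaping_def
  proof (intro conjI allI)
    show "finite (set_pmf (?r j))" for j using t q by (auto simp: escaping_def set_bind_pmf)
    fix n
    obtain J where "\<And>j. j \<ge> J \<Longrightarrow> set_pmf (q j) \<subseteq> {n..}" using q unfolding escaping_def by blast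
    then have "set_pmf (q (i + j)) \<subseteq> {n..}" if "J \<le> j" for i j using that by simp
    then have "\<forall>j\<ge>J. set_pmf (?r j) \<subseteq> {n..}" unfolding set_bind_pmf by blast
    then show "\<exists>J. \<forall>j\<ge>J. set_pmf (?r j) \<subseteq> {n..}" by blast
  qed
  then obtain u where u: "finite (set_pmf u)"
    and uB: "\<And>x. x \<in> B \<Longrightarrow> measure_pmf.prob (bind_pmf u ?r) {k. R x k} \<le> \<delta>"
    using negligible_forD[OF B _ \<delta>] by blast
  have uA: "measure_pmf.prob (bind_pmf u ?r) {k. R x k} \<le> \<delta>" if "x \<in> A" for x
    by (rule prob_bind_pmf_le[OF tA[OF that] less_imp_le[OF \<delta>]])
  let ?t = "bind_pmf u (\<lambda>n. map_pmf (\<lambda>j. j + n) (t n))"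
  have "bind_pmf ?t q = bind_pmf u ?r" by (simp add: bind_assoc_pmf bind_map_pmf)
  moreover have "finite (set_pmf ?t)" using u t by (auto simp: set_bind_pmf)
  ultimately show "\<exists>t. finite (set_pmf t) \<and>
      (\<forall>x\<in>A \<union> B. measure_pmf.prob (bind_pmf t q) {k. R x k} \<le> \<delta>)"
    using uA uB by (intro exI[of _ ?t]) auto
qed

lemma negligible_for_empty: "negligible_for R {}"
  unfolding negligible_for_def by (intro allI impI exI[of _ "return_pmf 0"]) simp

lemma negligible_for_finite_UN:
  "finite K \<Longrightarrow> (\<And>k. k \<in> K \<Longrightarrow> negligible_for R (A k)) \<Longrightarrow> negligible_for R (\<Union>k\<in>K. A k)"
  by (induction K rule: finite_induct) (simp_all add: negligible_for_empty negligible_for_Un)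

text \<open>
  Average \<open>Suc m\<close> means, each chosen to be at most \<open>\<delta> / 2\<close> on those points that hit the support of an
  earlier one; these points form a finite union of negligible sets. Then for a given point at most
  one of the means, the first that it charges, is large, so the average is at most
  \<open>1 / Suc m + \<delta> / 2\<close>.
\<close>
lemma negligible_for_step:
  assumes neg: "\<And>k. n \<le> k \<Longrightarrow> negligible_for R {x\<in>A. R x k}"
  shows "negligible_for R A"
  unfolding negligible_for_def
proof (intro allI impI)
  fix q0 and \<delta> :: real assume q0: "escaping q0" and \<delta>: "0 < \<delta>"
  \<comment> \<open>only the subsets hitting some \<open>k \<ge> n\<close> are known to be negligible, so \<open>q0\<close> is shifted first\<close>
  obtain J where J: "\<And>j. j \<ge> J \<Longrightarrow> set_pmf (q0 j) \<subseteq> {n..}" using q0 unfolding escaping_def by blast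
  define q where "q = (\<lambda>j. q0 (j + J))"
  have q: "escaping q" unfolding q_def using q0 by (rule escaping_shift)
  have qn: "set_pmf (q j) \<subseteq> {n..}" for j unfolding q_def using J by simp
  let ?P = "\<lambda>t x. measure_pmf.prob (bind_pmf t q) {k. R x k}"
  have avg: "\<exists>t. finite (set_pmf t) \<and> (\<forall>x\<in>A. ?P t x \<le> 1 / real (Suc m) + \<delta> / 2)" for m
  proof (induction m)
    case 0
    have "?P (return_pmf 0) x \<le> 1 / real (Suc 0) + \<delta> / 2" for x
      using measure_pmf.prob_le_1[of "q 0" "{k. R x k}"] \<delta> by (simp add: bind_return_pmf add_increasing2)
    then show ?case by (intro exI[of _ "return_pmf 0"]) auto
  next
    case (Suc m)
    then obtain t where t: "finite (set_pmf t)" "\<And>x. x \<in> A \<Longrightarrow> ?P t x \<le> 1 / real (Suc m) + \<delta> / 2"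
      by blast
    let ?K = "set_pmf (bind_pmf t q)"
    have "finite ?K" using t(1) q by (auto simp: set_bind_pmf escaping_def)
    moreover have "negligible_for R {x\<in>A. R x k}" if "k \<in> ?K" for k
      using that qn by (intro neg) (auto simp: set_bind_pmf)
    ultimately have "negligible_for R (\<Union>k\<in>?K. {x\<in>A. R x k})"
      by (rule negligible_for_finite_UN)
    from negligible_forD[OF this q half_gt_zero[OF \<delta>]]
    obtain t' where t': "finite (set_pmf t')"
      and small: "\<And>x. x \<in> (\<Union>k\<in>?K. {x\<in>A. R x k}) \<Longrightarrow> ?P t' x \<le> \<delta> / 2" by blast
    \<comment> \<open>the weight that turns an average of \<open>Suc m\<close> means into one of \<open>Suc (Suc m)\<close>\<close>
    define c where "c = real (Suc m) / real (Suc (Suc m))"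
    have c: "0 \<le> c" "c \<le> 1" "1 - c = 1 / real (Suc (Suc m))"
      unfolding c_def by (auto simp: field_simps)
    let ?t = "bind_pmf (bernoulli_pmf c) (\<lambda>b. if b then t else t')"
    have "bind_pmf ?t q = bind_pmf (bernoulli_pmf c) (\<lambda>b. if b then bind_pmf t q else bind_pmf t' q)"
      by (simp add: bind_assoc_pmf if_distrib[of "\<lambda>t. bind_pmf t q"])
    then have P: "?P ?t x = c * ?P t x + (1 - c) * ?P t' x" for x
      using prob_bernoulli_mixture[OF c(1,2)] by simp
    have "?P ?t x \<le> 1 / real (Suc (Suc m)) + \<delta> / 2" if x: "x \<in> A" for x
    proof (cases "?P t x = 0")
      case True
      have "(1 - c) * ?P t' x \<le> (1 - c) * 1" using c by (intro mult_left_mono) auto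
      then show ?thesis unfolding P True using c(3) \<delta> by simp
    next
      case False
      then have "x \<in> (\<Union>k\<in>?K. {x\<in>A. R x k})"
        using x by (auto simp: measure_pmf_zero_iff simp del: set_bind_pmf)
      then have "(1 - c) * ?P t' x \<le> (1 - c) * (\<delta> / 2)" using small c by (intro mult_left_mono) auto
      moreover have "c * ?P t x \<le> c * (1 / real (Suc m) + \<delta> / 2)"
        using t(2)[OF x] c by (intro mult_left_mono) auto
      moreover have "c * (1 / real (Suc m) + \<delta> / 2) + (1 - c) * (\<delta> / 2) = c / real (Suc m) + \<delta> / 2"
        by (simp add: field_simps)
      moreover have "c / real (Suc m) = 1 / real (Suc (Suc m))" unfolding c_def by simp
      ultimately show ?thesis unfolding P by linarith
    qed
    moreover have "finite (set_pmf ?t)" using t(1) t' by (auto simp: set_bind_pmf)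
    ultimately show ?case by blast
  qed
  obtain m where "1 / real (Suc m) < \<delta> / 2" using \<delta> nat_approx_posE[of "\<delta> / 2"] by auto
  then obtain t where t: "finite (set_pmf t)" "\<And>x. x \<in> A \<Longrightarrow> ?P t x \<le> \<delta>"
    using avg[of m] by fastforce
  have "bind_pmf (map_pmf (\<lambda>j. j + J) t) q0 = bind_pmf t q" unfolding q_def by (simp add: bind_map_pmf)
  then show "\<exists>t. finite (set_pmf t) \<and> (\<forall>x\<in>A. measure_pmf.prob (bind_pmf t q0) {k. R x k} \<le> \<delta>)"
    using t by (intro exI[of _ "map_pmf (\<lambda>j. j + J) t"]) auto
qed

text \<open>
  By the previous lemma a set that is not negligible contains, for arbitrarily large \<open>k\<close>, a
  non-negligible subset all of whose points hit \<open>k\<close>. Starting from the whole space, which the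
  hypothesis makes non-negligible, dependent choice produces the sequence; non-negligible sets are
  non-empty.
\<close>
theorem ptak_infinite_sequence:
  fixes R :: "'x \<Rightarrow> nat \<Rightarrow> bool"
  assumes big: "\<And>t. finite (set_pmf t) \<Longrightarrow> \<exists>x. \<delta> < measure_pmf.prob t {k. R x k}" and \<delta>: "0 < \<delta>"
  obtains s :: "nat \<Rightarrow> nat" where "strict_mono s" "\<And>m. \<exists>x. \<forall>i<m. R x (s i)"
proof -
  have "escaping return_pmf" unfolding escaping_def by auto
  then have start: "\<not> negligible_for R UNIV"
  proof (intro notI)
    assume "negligible_for R UNIV"
    from negligible_forD[OF this \<open>escaping return_pmf\<close> \<delta>]
    obtain t where "finite (set_pmf t)" "\<And>x. measure_pmf.prob t {k. R x k} \<le> \<delta>"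
      by (auto simp: bind_return_pmf')
    then show False using big[of t] by (meson not_le)
  qed
  let ?P = "\<lambda>y :: nat \<times> 'x set. \<not> negligible_for R (snd y)"
  let ?Q = "\<lambda>y z. fst y < fst z \<and> snd z = {x \<in> snd y. R x (fst z)}"
  have "\<exists>f. \<forall>n. ?P (f n) \<and> ?Q (f n) (f (Suc n))"
  proof (rule dependent_nat_choice[where P = "\<lambda>_. ?P" and Q = "\<lambda>_. ?Q"])
    show "\<exists>y. ?P y" using start by (intro exI[of _ "(0, UNIV)"]) simp
    fix y :: "nat \<times> 'x set" assume "?P y"
    then obtain k where "Suc (fst y) \<le> k" "\<not> negligible_for R {x \<in> snd y. R x k}"
      using negligible_for_step[of "Suc (fst y)" R "snd y"] by blast
    then show "\<exists>z. ?P z \<and> ?Q y z" by (intro exI[of _ "(k, {x \<in> snd y. R x k})"]) auto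
  qed
  then obtain f where f: "\<forall>n. ?P (f n) \<and> ?Q (f n) (f (Suc n))" ..
  define s where "s i = fst (f (Suc i))" for i
  have mono: "strict_mono s" unfolding strict_mono_Suc_iff s_def using f by blast
  have "\<exists>x. \<forall>i<m. R x (s i)" for m
  proof -
    have sub: "snd (f m) \<subseteq> {x. \<forall>i<m. R x (s i)}"
    proof (induction m)
      case (Suc m)
      have "snd (f (Suc m)) = {x \<in> snd (f m). R x (s m)}" using f unfolding s_def by blast
      then show ?case using Suc by (auto simp: less_Suc_eq)
    qed auto
    have "snd (f m) \<noteq> {}" using f negligible_for_empty by metis
    then show ?thesis using sub by blast
  qed
  then show ?thesis by (rule that[OF mono])
qed

section \<open>Thin sets\<close>

text \<open>
  For Borel sets this is a finitary certificate of being Haar null. Because the scale \<open>\<epsilon>\<close> is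
  arbitrary, certificates for different sets and different \<open>\<delta>\<close> can be added up in one convergent
  random series, which is how countably many thin sets are handled by a single measure.
\<close>
definition thin :: "'a::real_normed_vector set \<Rightarrow> bool" where
  "thin A \<longleftrightarrow> (\<forall>\<epsilon>>0. \<forall>\<delta>>0. \<exists>p. finite (set_pmf p) \<and> set_pmf p \<subseteq> cball 0 \<epsilon> \<and>
     (\<forall>x. measure_pmf.prob p {y. x + y \<in> A} \<le> \<delta>))"

lemma thin_empty: "thin {}"
  unfolding thin_def
proof (intro allI impI)
  fix \<epsilon> \<delta> :: real assume "0 < \<epsilon>" "0 < \<delta>"
  then have "set_pmf (return_pmf (0 :: 'a)) \<subseteq> cball 0 \<epsilon>"
    "\<forall>x :: 'a. measure_pmf.prob (return_pmf 0) {y. x + y \<in> {}} \<le> \<delta>"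
    by auto
  then show "\<exists>p. finite (set_pmf p) \<and> set_pmf p \<subseteq> cball 0 \<epsilon> \<and>
     (\<forall>x :: 'a. measure_pmf.prob p {y. x + y \<in> {}} \<le> \<delta>)"
    by (intro exI[of _ "return_pmf 0"] conjI) auto
qed

text \<open>
  Spread the mass evenly over many points of a short segment in direction \<open>v\<close>; a translate of \<open>A\<close> contains
  at most one of them.
\<close>
lemma thin_if_lines_meet_once:
  fixes A :: "'a::real_normed_vector set"
  assumes v: "v \<noteq> 0"
    and once: "\<And>x s t. x + s *\<^sub>R v \<in> A \<Longrightarrow> x + t *\<^sub>R v \<in> A \<Longrightarrow> s = t"
  shows "thin A"
  unfolding thin_def
proof (intro allI impI)
  fix \<epsilon> \<delta> :: real assume \<epsilon>: "0 < \<epsilon>" and \<delta>: "0 < \<delta>"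
  obtain m where m: "1 / real (Suc m) < \<delta>" using nat_approx_posE[OF \<delta>] by auto
  let ?N = "Suc m"
  define h where "h = \<epsilon> / (real ?N * norm v)"
  have h: "0 < h" unfolding h_def using \<epsilon> v by simp
  let ?g = "\<lambda>i::nat. (h * real i) *\<^sub>R v"
  let ?p = "map_pmf ?g (pmf_of_set {..<?N})"
  have set: "set_pmf ?p = ?g ` {..<?N}" by (simp add: lessThan_empty_iff)
  have "norm (?g i) \<le> \<epsilon>" if "i < ?N" for i
  proof -
    have "norm (?g i) = \<epsilon> * (real i / real ?N)" using \<epsilon> v unfolding h_def by (simp add: abs_mult)
    also have "\<dots> \<le> \<epsilon> * 1" using \<epsilon> that by (intro mult_left_mono) auto
    finally show ?thesis by simp
  qed
  then have ball: "set_pmf ?p \<subseteq> cball 0 \<epsilon>" unfolding set by auto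
  have "measure_pmf.prob ?p {y. x + y \<in> A} \<le> \<delta>" for x
  proof -
    let ?S = "{..<?N} \<inter> ?g -` {y. x + y \<in> A}"
    have "\<forall>i\<in>?S. \<forall>j\<in>?S. i = j" using once[of x] h by fastforce
    then have "card ?S \<le> 1" by (metis card_le_Suc0_iff_eq finite_Int finite_lessThan One_nat_def)
    then have "real (card ?S) / real ?N \<le> 1 / real ?N" by (simp add: divide_right_mono)
    moreover have "measure_pmf.prob ?p {y. x + y \<in> A} = real (card ?S) / real ?N"
      by (simp add: measure_pmf_of_set lessThan_empty_iff)
    ultimately show ?thesis using m by linarith
  qed
  then show "\<exists>p. finite (set_pmf p) \<and> set_pmf p \<subseteq> cball 0 \<epsilon> \<and>
     (\<forall>x. measure_pmf.prob p {y. x + y \<in> A} \<le> \<delta>)"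
    using ball set by (intro exI[of _ ?p]) auto
qed

section \<open>Convex sets covering a ball up to a finite-dimensional error\<close>

lemma convex_closed_dyadic_series:
  fixes S :: "'a::real_normed_vector set"
  assumes S: "convex S" "closed S" and s: "\<And>i. s i \<in> S"
    and sums: "(\<lambda>i. (1/2) ^ Suc i *\<^sub>R s i) sums l"
  shows "l \<in> S"
proof -
  \<comment> \<open>the remaining weight of a partial sum is put on an arbitrary point of \<open>S\<close>\<close>
  have part: "(\<Sum>i<n. (1/2) ^ Suc i *\<^sub>R s i) + (1/2) ^ n *\<^sub>R a \<in> S" if "a \<in> S" for a n
    using that
  proof (induction n arbitrary: a)
    case (Suc n)
    have "(1/2) *\<^sub>R s n + (1/2) *\<^sub>R a \<in> S" using S(1) s Suc.prems by (intro convexD) auto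
    from Suc.IH[OF this] show ?case by (simp add: scaleR_add_right add.assoc mult.commute)
  qed simp
  have "(\<lambda>n. (\<Sum>i<n. (1/2) ^ Suc i *\<^sub>R s i) + (1/2) ^ n *\<^sub>R s 0) \<longlonglongrightarrow> l + 0 *\<^sub>R s 0"
    using sums unfolding sums_def by (intro tendsto_intros LIMSEQ_realpow_zero) auto
  moreover have "\<forall>n. (\<Sum>i<n. (1/2) ^ Suc i *\<^sub>R s i) + (1/2) ^ n *\<^sub>R s 0 \<in> S" using part s by blast
  ultimately show ?thesis using closed_sequentially[OF S(2)] by fastforce
qed

text \<open>
  A cancellation law: if \<open>C - K\<close> covers a ball of radius \<open>\<epsilon>\<close> up to an error \<open>\<epsilon> / 2\<close>, it contains
  the ball of half the radius. The doubled error is again a vector of the \<open>\<epsilon>\<close>-ball, so iterating the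
  approximation writes \<open>y / 2\<close> as a series with weights \<open>1/2, 1/4, \<dots>\<close> in \<open>C - K\<close>. The part in
  \<open>K\<close> converges because \<open>K\<close> is bounded, hence so does the part in \<open>C\<close>.
\<close>
lemma half_ball_in_difference:
  fixes C K :: "'a::banach set"
  assumes C: "closed C" "convex C" and K: "closed K" "convex K" "bounded K"
    and cov: "\<And>y. norm y \<le> \<epsilon> \<Longrightarrow> \<exists>c\<in>C. \<exists>k\<in>K. norm (y - (c - k)) \<le> \<epsilon> / 2"
    and y: "norm y \<le> \<epsilon>"
  shows "\<exists>c\<in>C. \<exists>k\<in>K. (1/2) *\<^sub>R y = c - k"
proof -
  obtain cf kf where cf: "\<And>y. norm y \<le> \<epsilon> \<Longrightarrow> cf y \<in> C" and kf: "\<And>y. norm y \<le> \<epsilon> \<Longrightarrow> kf y \<in> K"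
    and err: "\<And>y. norm y \<le> \<epsilon> \<Longrightarrow> norm (y - (cf y - kf y)) \<le> \<epsilon> / 2"
    using cov by metis
  define z where "z = rec_nat y (\<lambda>_ z. 2 *\<^sub>R (z - (cf z - kf z)))"
  have z0: "z 0 = y" and zS: "z (Suc n) = 2 *\<^sub>R (z n - (cf (z n) - kf (z n)))" for n
    unfolding z_def by auto
  have zn: "norm (z n) \<le> \<epsilon>" for n
  proof (induction n)
    case (Suc n)
    then show ?case using err[OF Suc] unfolding zS by simp
  qed (simp add: z0 y)
  define c where "c n = cf (z n)" for n
  define k where "k n = kf (z n)" for n
  have cC: "c n \<in> C" and kK: "k n \<in> K" for n unfolding c_def k_def using cf kf zn by auto
  have half: "(1/2) *\<^sub>R y = (\<Sum>i<n. (1/2) ^ Suc i *\<^sub>R (c i - k i)) + (1/2) ^ Suc n *\<^sub>R z n" for n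
  proof (induction n)
    case (Suc n)
    have "(1/2) ^ Suc (Suc n) *\<^sub>R z (Suc n) = (1/2) ^ Suc n *\<^sub>R z n - (1/2) ^ Suc n *\<^sub>R (c n - k n)"
      unfolding zS c_def k_def by (simp add: scaleR_diff_right)
    then show ?case unfolding Suc sum.lessThan_Suc by simp
  qed (simp add: z0)
  obtain M where M: "\<And>a. a \<in> K \<Longrightarrow> norm a \<le> M" using K(3) unfolding bounded_iff by blast
  have "summable (\<lambda>i. (1/2) ^ Suc i *\<^sub>R k i)"
  proof (rule summable_norm_cancel, rule summable_comparison_test')
    show "summable (\<lambda>i. (1/2) ^ Suc i * M)"
      by (intro summable_mult2) (simp add: summable_geometric)
    show "norm (norm ((1/2) ^ Suc n *\<^sub>R k n)) \<le> (1/2) ^ Suc n * M" if "0 \<le> n" for n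
      using M[OF kK] by (simp add: mult_left_mono)
  qed
  then obtain k' where k': "(\<lambda>i. (1/2) ^ Suc i *\<^sub>R k i) sums k'" unfolding summable_def by blast
  have "(\<lambda>n. (1/2) ^ Suc n *\<^sub>R z n) \<longlonglongrightarrow> 0"
  proof (rule Lim_null_comparison)
    show "\<forall>\<^sub>F n in sequentially. norm ((1/2) ^ Suc n *\<^sub>R z n) \<le> (1/2) ^ Suc n * \<epsilon>"
      using zn by (simp add: mult_left_mono)
    have "(\<lambda>n. (1/2::real) ^ Suc n * \<epsilon>) \<longlonglongrightarrow> 0 * \<epsilon>"
      by (intro tendsto_intros LIMSEQ_Suc LIMSEQ_realpow_zero) auto
    then show "(\<lambda>n. (1/2::real) ^ Suc n * \<epsilon>) \<longlonglongrightarrow> 0" by simp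
  qed
  then have "(\<lambda>n. (1/2) *\<^sub>R y - (1/2) ^ Suc n *\<^sub>R z n + (\<Sum>i<n. (1/2) ^ Suc i *\<^sub>R k i))
      \<longlonglongrightarrow> (1/2) *\<^sub>R y - 0 + k'"
    using k' unfolding sums_def by (intro tendsto_intros)
  moreover have "(1/2) *\<^sub>R y - (1/2) ^ Suc n *\<^sub>R z n + (\<Sum>i<n. (1/2) ^ Suc i *\<^sub>R k i)
      = (\<Sum>i<n. (1/2) ^ Suc i *\<^sub>R c i)" for n
    unfolding half[of n] by (simp add: scaleR_diff_right sum_subtractf)
  ultimately have c': "(\<lambda>i. (1/2) ^ Suc i *\<^sub>R c i) sums ((1/2) *\<^sub>R y + k')"
    unfolding sums_def by simp
  have "(1/2) *\<^sub>R y + k' \<in> C" using convex_closed_dyadic_series[OF C(2,1) cC c'] .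
  moreover have "k' \<in> K" using convex_closed_dyadic_series[OF K(2,1) kK k'] .
  ultimately show ?thesis by (intro bexI[of _ "(1/2) *\<^sub>R y + k'"] bexI[of _ k']) auto
qed

text \<open>
  For convex \<open>C\<close> containing \<open>p\<close> these are the feasible directions of \<open>C\<close> at \<open>p\<close>, a convex cone.
\<close>
definition cone_at :: "'a::real_vector set \<Rightarrow> 'a \<Rightarrow> 'a set" where
  "cone_at C p = {e. \<exists>s>0. p + s *\<^sub>R e \<in> C}"

lemma convex_segment_shrink:
  assumes "convex C" "p \<in> C" "p + s *\<^sub>R e \<in> C" "0 \<le> t" "t \<le> s"
  shows "p + t *\<^sub>R e \<in> C"
proof (cases "s = 0")
  case False
  have "(1 - t / s) *\<^sub>R p + (t / s) *\<^sub>R (p + s *\<^sub>R e) \<in> C"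
    using assms False by (intro convexD) (auto simp: field_simps)
  moreover have "(1 - t / s) *\<^sub>R p + (t / s) *\<^sub>R (p + s *\<^sub>R e) = p + t *\<^sub>R e"
    using False by (simp add: algebra_simps)
  ultimately show ?thesis by simp
qed (use assms in auto)

lemma cone_at_add:
  assumes C: "convex C" "p \<in> C" and e: "e \<in> cone_at C p" "e' \<in> cone_at C p"
  shows "e + e' \<in> cone_at C p"
proof -
  obtain s s' where s: "0 < s" "p + s *\<^sub>R e \<in> C" "0 < s'" "p + s' *\<^sub>R e' \<in> C"
    using e unfolding cone_at_def by blast
  let ?r = "min s s'"
  have "p + ?r *\<^sub>R e \<in> C" "p + ?r *\<^sub>R e' \<in> C"
    using s convex_segment_shrink[OF C s(2), of ?r] convex_segment_shrink[OF C s(4), of ?r] by auto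
  then have "(1/2) *\<^sub>R (p + ?r *\<^sub>R e) + (1/2) *\<^sub>R (p + ?r *\<^sub>R e') \<in> C"
    using C by (intro convexD) auto
  moreover have "(1/2) *\<^sub>R (p + ?r *\<^sub>R e) + (1/2) *\<^sub>R (p + ?r *\<^sub>R e') = p + (?r / 2) *\<^sub>R (e + e')"
    by (simp add: scaleR_add_right) (simp flip: scaleR_add_left)
  ultimately show ?thesis unfolding cone_at_def using s by (auto intro!: exI[of _ "?r / 2"])
qed

lemma cone_at_scale:
  assumes "p \<in> C" "e \<in> cone_at C p" "0 \<le> k"
  shows "k *\<^sub>R e \<in> cone_at C p"
proof (cases "k = 0")
  case True
  then show ?thesis using assms(1) unfolding cone_at_def by (auto intro: exI[of _ 1])
next
  case False
  then have k: "0 < k" using assms by simp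
  obtain s where "0 < s" "p + s *\<^sub>R e \<in> C" using assms(2) unfolding cone_at_def by blast
  then show ?thesis unfolding cone_at_def using k by (auto intro!: exI[of _ "s / k"])
qed

text \<open>
  Moving the base point towards another point of \<open>C\<close> loses no feasible direction. Repeated
  midpoints therefore collect finitely many requirements into one base point.
\<close>
lemma cone_at_midpoint:
  assumes C: "convex C" "q \<in> C" and e: "e \<in> cone_at C p"
  shows "e \<in> cone_at C (midpoint p q)"
proof -
  obtain s where s: "0 < s" "p + s *\<^sub>R e \<in> C" using e unfolding cone_at_def by blast
  have "(1/2) *\<^sub>R (p + s *\<^sub>R e) + (1/2) *\<^sub>R q \<in> C" using C s by (intro convexD) auto
  moreover have "(1/2) *\<^sub>R (p + s *\<^sub>R e) + (1/2) *\<^sub>R q = midpoint p q + (s / 2) *\<^sub>R e"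
    by (simp add: midpoint_def scaleR_add_right)
  ultimately show ?thesis unfolding cone_at_def using s by (auto intro!: exI[of _ "s / 2"])
qed

lemma cone_at_midpoint_diff:
  assumes "p \<in> C"
  shows "p - q \<in> cone_at C (midpoint p q)"
proof -
  have "midpoint p q + (1/2) *\<^sub>R (p - q) = (1/2 + 1/2) *\<^sub>R p"
    unfolding midpoint_def scaleR_add_left by (simp add: scaleR_diff_right scaleR_add_right)
  then show ?thesis unfolding cone_at_def using assms by (auto intro!: exI[of _ "1/2"])
qed

lemma subspace_two_sided_cone:
  assumes C: "convex C" "p \<in> C"
  shows "subspace {e. e \<in> cone_at C p \<and> - e \<in> cone_at C p}"
proof (rule subspaceI)
  show "0 \<in> {e. e \<in> cone_at C p \<and> - e \<in> cone_at C p}"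
    using C(2) unfolding cone_at_def by (auto intro: exI[of _ 1])
  fix x y assume "x \<in> {e. e \<in> cone_at C p \<and> - e \<in> cone_at C p}" "y \<in> {e. e \<in> cone_at C p \<and> - e \<in> cone_at C p}"
  then show "x + y \<in> {e. e \<in> cone_at C p \<and> - e \<in> cone_at C p}"
    using cone_at_add[OF C, of x y] cone_at_add[OF C, of "- x" "- y"] by simp
next
  fix k x assume x: "x \<in> {e. e \<in> cone_at C p \<and> - e \<in> cone_at C p}"
  show "k *\<^sub>R x \<in> {e. e \<in> cone_at C p \<and> - e \<in> cone_at C p}"
  proof (cases "0 \<le> k")
    case True
    then show ?thesis using x cone_at_scale[OF C(2), of x k] cone_at_scale[OF C(2), of "- x" k] by simp
  next
    case False
    then show ?thesis using x cone_at_scale[OF C(2), of x "- k"] cone_at_scale[OF C(2), of "- x" "- k"] by simp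
  qed
qed

text \<open>
  At the midpoint of \<open>a\<close> and \<open>b\<close> both directions \<open>\<plusminus> (a - b)\<close> are feasible; midpoints combine
  this for the summands of a linear combination.
\<close>
lemma convex_two_sided_point:
  assumes C: "convex C" "C \<noteq> {}" and e: "e \<in> span {a - b | a b. a \<in> C \<and> b \<in> C}"
  shows "\<exists>p\<in>C. e \<in> cone_at C p \<and> - e \<in> cone_at C p"
  using e
proof (induction rule: span_induct_alt)
  case base
  obtain p where "p \<in> C" using C by blast
  then show ?case unfolding cone_at_def by (auto intro!: bexI[of _ p] exI[of _ 1])
next
  case (step k x e)
  obtain a b where ab: "a \<in> C" "b \<in> C" "x = a - b" using step by blast
  obtain p where p: "p \<in> C" "e \<in> cone_at C p" "- e \<in> cone_at C p" using step by blast
  let ?m = "midpoint a b" and ?q = "midpoint (midpoint a b) p"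
  have mid: "midpoint u v \<in> C" if "u \<in> C" "v \<in> C" for u v
    using C(1) that unfolding midpoint_def scaleR_add_right by (intro convexD) auto
  have m: "?m \<in> C" and q: "?q \<in> C" using mid ab p by auto
  have "x \<in> cone_at C ?m" "- x \<in> cone_at C ?m"
    using cone_at_midpoint_diff[OF ab(1), of b] cone_at_midpoint_diff[OF ab(2), of a] ab(3)
    by (auto simp: midpoint_sym)
  then have x: "x \<in> {e. e \<in> cone_at C ?q \<and> - e \<in> cone_at C ?q}"
    using cone_at_midpoint[OF C(1) p(1)] by blast
  have "e \<in> {e. e \<in> cone_at C ?q \<and> - e \<in> cone_at C ?q}"
    using cone_at_midpoint[OF C(1) m p(2)] cone_at_midpoint[OF C(1) m p(3)] by (simp add: midpoint_sym)
  with x have "k *\<^sub>R x + e \<in> {e. e \<in> cone_at C ?q \<and> - e \<in> cone_at C ?q}"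
    using subspace_two_sided_cone[OF C(1) q] by (intro subspace_add subspace_scale)
  then show ?case using q by blast
qed

lemma convex_two_sided_point_finite:
  assumes C: "convex C" "C \<noteq> {}" and E: "finite E" "E \<subseteq> span {a - b | a b. a \<in> C \<and> b \<in> C}"
  shows "\<exists>p\<in>C. \<forall>e\<in>E. e \<in> cone_at C p \<and> - e \<in> cone_at C p"
  using E
proof (induction E rule: finite_induct)
  case (insert e E)
  obtain p where p: "p \<in> C" "e \<in> cone_at C p" "- e \<in> cone_at C p"
    using convex_two_sided_point[OF C] insert.prems by blast
  obtain q where q: "q \<in> C" "\<And>e. e \<in> E \<Longrightarrow> e \<in> cone_at C q \<and> - e \<in> cone_at C q"
    using insert by blast
  have "midpoint p q \<in> C"
    using C(1) p q unfolding midpoint_def scaleR_add_right by (intro convexD) auto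
  moreover have "d \<in> cone_at C (midpoint p q) \<and> - d \<in> cone_at C (midpoint p q)" if "d \<in> insert e E" for d
    using that p q cone_at_midpoint[OF C(1) q(1), of _ p] cone_at_midpoint[OF C(1) p(1), of _ q]
    by (auto simp: midpoint_sym)
  ultimately show ?case by blast
qed (use C in auto)

text \<open>
  Baire: the closed sets of those \<open>x\<close> with \<open>p + x / n \<in> C\<close> cover the space, so one of them has
  interior, and it is an affine copy of \<open>C\<close>.
\<close>
lemma interior_nonempty_if_absorbing:
  fixes C :: "'a::banach set"
  assumes C: "closed C" "convex C" "p \<in> C" and abs: "cone_at C p = UNIV"
  shows "interior C \<noteq> {}"
proof -
  define G where "G n = {x. p + (1 / real (Suc n)) *\<^sub>R x \<in> C}" for n
  have clG: "closed (G n)" for n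
  proof -
    have "G n = (\<lambda>x. p + (1 / real (Suc n)) *\<^sub>R x) -` C" unfolding G_def by auto
    then show ?thesis using C(1) by (auto intro!: continuous_closed_vimage continuous_intros)
  qed
  have UG: "(\<Union>n. G n) = UNIV"
  proof (intro equalityI subsetI UNIV_I)
    fix x
    have "x \<in> cone_at C p" using abs by simp
    then obtain s where s: "0 < s" "p + s *\<^sub>R x \<in> C" unfolding cone_at_def by blast
    obtain n where "1 / real (Suc n) < s" using nat_approx_posE[OF s(1)] by auto
    then have "p + (1 / real (Suc n)) *\<^sub>R x \<in> C"
      using convex_segment_shrink[OF C(2,3) s(2), of "1 / real (Suc n)"] by simp
    then show "x \<in> (\<Union>n. G n)" unfolding G_def by blast
  qed
  have "\<exists>n. interior (G n) \<noteq> {}"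
  proof (rule ccontr)
    assume "\<not> ?thesis"
    then have "euclidean interior_of (\<Union>(range G)) = {}"
      using clG by (intro Baire_category_alt) (auto simp: completely_metrizable_space_euclidean)
    then show False using UG by simp
  qed
  then obtain n where n: "interior (G n) \<noteq> {}" by blast
  let ?h = "\<lambda>z. real (Suc n) *\<^sub>R (z - p)"
  have "open (?h -` interior (G n))"
    by (intro continuous_open_vimage) (auto intro!: continuous_intros)
  moreover have "?h -` interior (G n) \<subseteq> C"
  proof
    fix z assume "z \<in> ?h -` interior (G n)"
    then have "?h z \<in> G n" using interior_subset by auto
    then show "z \<in> C" unfolding G_def by simp
  qed
  moreover have "?h -` interior (G n) \<noteq> {}"
  proof -
    obtain x where "x \<in> interior (G n)" using n by blast
    then have "p + (1 / real (Suc n)) *\<^sub>R x \<in> ?h -` interior (G n)" by simp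
    then show ?thesis by blast
  qed
  ultimately show ?thesis using interior_maximal by blast
qed

text \<open>
  The cancellation law gives \<open>C - convex hull E\<close> a ball. Choose a base point \<open>p\<close> in \<open>C\<close> at which every
  direction in \<open>span E\<close> is feasible. With \<open>0 = c - k\<close>, a vector of the ball is
  \<open>c' - k' = (c' - p) + (p - c) + (k - k')\<close>. The first term is feasible at \<open>p\<close>, the last is in
  \<open>span E\<close>, and \<open>p\<close> can be chosen to make the middle one feasible too. So \<open>C\<close> is absorbing at \<open>p\<close>.
\<close>
lemma interior_nonempty_if_finite_enlargement:
  fixes C :: "'a::banach set"
  assumes C: "closed C" "convex C" and span: "span {a - b | a b. a \<in> C \<and> b \<in> C} = UNIV"
    and E: "finite E" and \<epsilon>: "0 < \<epsilon>"
    and cov: "\<And>y. norm y \<le> \<epsilon> \<Longrightarrow> \<exists>c\<in>C. \<exists>k\<in>convex hull E. norm (y - (c - k)) \<le> \<epsilon> / 2"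
  shows "interior C \<noteq> {}"
proof -
  let ?K = "convex hull E"
  have K: "closed ?K" "convex ?K" "bounded ?K"
    using finite_imp_compact_convex_hull[OF E] by (auto simp: compact_imp_closed compact_imp_bounded)
  note half = half_ball_in_difference[OF C K cov]
  \<comment> \<open>representing \<open>0\<close> shows that \<open>C\<close> meets the hull\<close>
  obtain c k where ck: "c \<in> C" "k \<in> ?K" "c = k" using half[of 0] \<epsilon> by auto
  obtain q where q: "q \<in> C" "\<And>e. e \<in> E \<Longrightarrow> e \<in> cone_at C q \<and> - e \<in> cone_at C q"
    using convex_two_sided_point_finite[OF C(2) _ E] ck(1) span by auto
  \<comment> \<open>besides \<open>span E\<close>, the direction \<open>p - c\<close> becomes feasible\<close>
  define p where "p = midpoint q c"
  have p: "p \<in> C" unfolding p_def midpoint_def scaleR_add_right using C(2) q(1) ck(1) by (intro convexD) auto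
  have Ep: "E \<subseteq> {e. e \<in> cone_at C p \<and> - e \<in> cone_at C p}"
    unfolding p_def using q cone_at_midpoint[OF C(2) ck(1), of _ q] by blast
  have spanE: "span E \<subseteq> cone_at C p"
    using span_minimal[OF Ep subspace_two_sided_cone[OF C(2) p]] by blast
  have "(1/2) *\<^sub>R (q - c) \<in> cone_at C p"
    unfolding p_def by (intro cone_at_scale cone_at_midpoint_diff q p[unfolded p_def]) auto
  moreover have "p - c = (1/2) *\<^sub>R (q - c)"
    unfolding p_def midpoint_def by (simp add: scaleR_diff_right scaleR_add_right)
      (simp add: algebra_simps flip: scaleR_add_left)
  ultimately have pc: "p - c \<in> cone_at C p" by simp
  have "x \<in> cone_at C p" for x
  proof -
    define s where "s = \<epsilon> / (norm x + 1)"
    have s: "0 < s" unfolding s_def using \<epsilon> by (simp add: add_nonneg_pos)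
    have "norm (s *\<^sub>R x) = s * norm x" using s by simp
    also have "\<dots> = \<epsilon> * (norm x / (norm x + 1))" unfolding s_def by simp
    also have "\<dots> \<le> \<epsilon> * 1"
      using \<epsilon> add_nonneg_pos[OF norm_ge_zero zero_less_one, of x] by (intro mult_left_mono) auto
    finally have "norm (s *\<^sub>R x) \<le> \<epsilon>" by simp
    then obtain c' k' where c': "c' \<in> C" "k' \<in> ?K" "(1/2) *\<^sub>R s *\<^sub>R x = c' - k'" using half by metis
    have "c' - p \<in> cone_at C p" unfolding cone_at_def using c' by (auto intro!: exI[of _ 1])
    moreover have "k - k' \<in> cone_at C p"
      using spanE ck(2) c'(2) convex_hull_subset_span[of E] span_diff by blast
    ultimately have "(c' - p) + ((p - c) + (k - k')) \<in> cone_at C p"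
      using pc cone_at_add[OF C(2) p] by blast
    then have "(1/2) *\<^sub>R s *\<^sub>R x \<in> cone_at C p" using c'(3) ck(3) by simp
    from cone_at_scale[OF p this, of "2 / s"] show ?thesis using s by simp
  qed
  then show ?thesis by (intro interior_nonempty_if_absorbing[OF C p]) auto
qed

section \<open>Bounded closed convex sets with empty interior are thin\<close>

text \<open>
  If the differences of \<open>C\<close> do not span the space, lines in a missing direction meet \<open>C\<close> at most once.
  Otherwise let \<open>d\<close> enumerate a dense set. Since \<open>C\<close> has empty interior, no ball around \<open>0\<close> is covered by
  \<open>C - convex hull {d 0, \<dots>, d n}\<close> up to half its radius, which provides points \<open>y n\<close> of the \<open>\<epsilon>\<close>-ball
  that stay \<open>\<epsilon> / 2\<close> away from these sets. If \<open>C\<close> were not thin, every mean on the sequence \<open>y\<close> would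
  put mass above \<open>\<delta>\<close> on some translate of \<open>C\<close>, so by Ptak's lemma and reflexivity a subsequence of
  \<open>y\<close> would lie in a single translate \<open>C - x\<close>. Then \<open>y n = c - x\<close> for infinitely many \<open>n\<close>, and
  some \<open>d j\<close> is within \<open>\<epsilon> / 2\<close> of \<open>x\<close>, which contradicts the choice of \<open>y n\<close> once \<open>n \<ge> j\<close>.
\<close>
theorem thin_bounded_convex_empty_interior:
  fixes C :: "'a::banach set"
  assumes refl: "reflexive_space TYPE('a)"
    and dense: "\<And>x :: 'a. \<And>r. 0 < r \<Longrightarrow> \<exists>n :: nat. norm (x - d n) \<le> r"
    and C: "closed C" "convex C" "bounded C" "interior C = {}"
  shows "thin C"
proof (cases "span {a - b | a b. a \<in> C \<and> b \<in> C} = UNIV")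
  case False
  let ?V = "{a - b | a b. a \<in> C \<and> b \<in> C}"
  obtain v where v: "v \<notin> span ?V" using False by blast
  then have "v \<noteq> 0" by (auto simp: span_zero)
  then show ?thesis
  proof (rule thin_if_lines_meet_once)
    fix x s t assume "x + s *\<^sub>R v \<in> C" "x + t *\<^sub>R v \<in> C"
    then have "(x + s *\<^sub>R v) - (x + t *\<^sub>R v) \<in> span ?V" by (intro span_base) blast
    then have "(s - t) *\<^sub>R v \<in> span ?V" by (simp add: algebra_simps)
    then show "s = t" using v span_scale[of "(s - t) *\<^sub>R v" ?V "1 / (s - t)"] by (cases "s = t") auto
  qed
next
  case True
  show ?thesis unfolding thin_def
  proof (intro allI impI, rule ccontr)
    fix \<epsilon> \<delta> :: real assume \<epsilon>: "0 < \<epsilon>" and \<delta>: "0 < \<delta>"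
    assume no: "\<nexists>p. finite (set_pmf p) \<and> set_pmf p \<subseteq> cball 0 \<epsilon> \<and>
      (\<forall>x. measure_pmf.prob p {y. x + y \<in> C} \<le> \<delta>)"
    have "\<exists>y. norm y \<le> \<epsilon> \<and> (\<forall>c\<in>C. \<forall>k\<in>convex hull (d ` {..n}). \<epsilon> / 2 < norm (y - (c - k)))" for n
      using interior_nonempty_if_finite_enlargement[OF C(1,2) True _ \<epsilon>, of "d ` {..n}"] C(4)
      by (meson finite_atMost finite_imageI not_le)
    then obtain y where y: "\<And>n. norm (y n) \<le> \<epsilon>"
      and far: "\<And>n c k. c \<in> C \<Longrightarrow> k \<in> convex hull (d ` {..n}) \<Longrightarrow> \<epsilon> / 2 < norm (y n - (c - k))"
      by metis
    have "\<exists>x. \<delta> < measure_pmf.prob t {k. x + y k \<in> C}" if "finite (set_pmf t)" for t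
    proof -
      let ?p = "map_pmf y t"
      have "set_pmf ?p \<subseteq> cball 0 \<epsilon>" "finite (set_pmf ?p)" using y that by auto
      then have "\<not> (\<forall>x. measure_pmf.prob ?p {z. x + z \<in> C} \<le> \<delta>)" using no by blast
      then obtain x where "\<delta> < measure_pmf.prob ?p {z. x + z \<in> C}" by (auto simp: not_le)
      then show ?thesis by (auto simp: vimage_def)
    qed
    from ptak_infinite_sequence[OF this \<delta>] obtain s :: "nat \<Rightarrow> nat" where s: "strict_mono s"
      and fip: "\<And>m. \<exists>x. \<forall>i<m. x + y (s i) \<in> C" by blast
    define D where "D m = (\<Inter>i\<le>m. (\<lambda>x. y (s i) + x) -` C)" for m
    have vim: "(\<lambda>x. y (s i) + x) -` C = (\<lambda>x. - y (s i) + x) ` C" for i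
    proof (intro equalityI subsetI)
      fix x assume "x \<in> (\<lambda>x. y (s i) + x) -` C"
      then have "- y (s i) + (y (s i) + x) \<in> (\<lambda>x. - y (s i) + x) ` C" by blast
      then show "x \<in> (\<lambda>x. - y (s i) + x) ` C" by simp
    qed auto
    have "(\<Inter>m. D m) \<noteq> {}"
    proof (rule reflexive_decreasing_convex_Inter[where D = D, OF refl])
      show "closed (D n)" for n unfolding D_def vim by (intro closed_INT ballI closed_translation C)
      show "convex (D n)" for n unfolding D_def vim by (intro convex_INT convex_translation C)
      show "D n \<noteq> {}" for n
      proof -
        obtain x where "\<forall>i<Suc n. x + y (s i) \<in> C" using fip by blast
        then have "x \<in> D n" unfolding D_def by (simp add: add.commute less_Suc_eq_le)
        then show ?thesis by blast
      qed
      show "bounded (D 0)" using bounded_translation[OF C(3), of "- y (s 0)"] unfolding D_def vim by simp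
      show "decseq D" unfolding D_def decseq_def by auto
    qed
    then obtain x where xD: "\<And>m. x \<in> D m" by blast
    have x: "x + y (s i) \<in> C" for i using xD[of i] unfolding D_def by (auto simp: add.commute)
    obtain j where j: "norm (x - d j) \<le> \<epsilon> / 2" using dense[of "\<epsilon> / 2" x] \<epsilon> by auto
    have "d j \<in> convex hull (d ` {..s j})"
      using seq_suble[OF s, of j] by (intro hull_inc) auto
    moreover have "y (s j) - (x + y (s j) - d j) = d j - x" by simp
    ultimately show False using far[OF x[of j]] j by (fastforce simp: norm_minus_commute)
  qed
qed

section \<open>Boundaries of convex sets\<close>

text \<open>
  The accessibility lemma for convex sets, in arbitrary normed spaces. The point is also
  \<open>(1 - e) y + e z\<close> for a \<open>y\<close> in \<open>S\<close> close to \<open>x\<close> and a \<open>z\<close> close to \<open>c\<close>, and dilations are open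
  maps.
\<close>
lemma convex_interior_towards:
  fixes S :: "'a::real_normed_vector set"
  assumes S: "convex S" and c: "c \<in> interior S" and x: "x \<in> closure S" and e: "0 < e" "e \<le> 1"
  shows "x + e *\<^sub>R (c - x) \<in> interior S"
proof -
  obtain r where r: "0 < r" "ball c r \<subseteq> interior S"
    using c open_contains_ball[of "interior S"] by auto
  obtain y where y: "y \<in> S" "dist y x < e * r"
    using x e r unfolding closure_approachable by (meson mult_pos_pos)
  define z where "z = c + ((1 - e) / e) *\<^sub>R (x - y)"
  have "dist c z = ((1 - e) / e) * dist y x"
    unfolding z_def using e by (simp add: dist_norm norm_minus_commute)
  also have "\<dots> \<le> (1 / e) * dist y x" using e by (intro mult_right_mono divide_right_mono) auto
  also have "\<dots> < (1 / e) * (e * r)" using y e by (intro mult_strict_left_mono) auto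
  finally have "z \<in> ball c r" using e by simp
  then have z: "z \<in> interior S" using r by blast
  let ?h = "\<lambda>z. (1 - e) *\<^sub>R y + e *\<^sub>R z"
  have "open (?h ` interior S)" using e by (intro open_affinity) auto
  moreover have "?h ` interior S \<subseteq> S"
    using S y e interior_subset by (auto intro!: convexD)
  ultimately have "?h ` interior S \<subseteq> interior S" by (simp add: interior_maximal)
  moreover have "?h z = x + e *\<^sub>R (c - x)"
    unfolding z_def using e by (simp add: scaleR_add_right scaleR_diff_right scaleR_diff_left)
  ultimately show ?thesis using z by (metis image_subset_iff)
qed

text \<open>
  The boundary of a convex set can contain segments, so one direction need not serve for all
  of it. But the part from which \<open>v\<close> leads into the interior meets each line parallel to \<open>v\<close> at most once,
  because a later point on the line would lie strictly between a closure point and an interior point.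
\<close>
lemma thin_frontier_seen_along:
  fixes C :: "'a::real_normed_vector set"
  assumes C: "convex C"
  shows "thin {x \<in> frontier C. x + v \<in> interior C}"
proof (cases "v = 0")
  case True
  then have eq: "{x \<in> frontier C. x + v \<in> interior C} = {}" by (auto simp: frontier_def)
  show ?thesis unfolding eq by (rule thin_empty)
next
  case False
  have one: "\<not> s < t" if s: "x + s *\<^sub>R v \<in> frontier C"
    and t: "x + t *\<^sub>R v \<in> frontier C" "x + t *\<^sub>R v + v \<in> interior C" for x s t
  proof
    assume "s < t"
    define e where "e = (t - s) / (1 + t - s)"
    have pos: "0 < 1 + t - s" using \<open>s < t\<close> by simp
    have e: "0 < e" "e \<le> 1" unfolding e_def using \<open>s < t\<close> pos by simp_all
    have "e * (1 + t - s) = t - s" unfolding e_def using pos by simp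
    moreover have "x + t *\<^sub>R v + v - (x + s *\<^sub>R v) = (1 + t - s) *\<^sub>R v" by (simp add: algebra_simps)
    ultimately have "x + s *\<^sub>R v + e *\<^sub>R (x + t *\<^sub>R v + v - (x + s *\<^sub>R v)) = x + s *\<^sub>R v + (t - s) *\<^sub>R v"
      by simp
    also have "\<dots> = x + t *\<^sub>R v" by (simp add: algebra_simps)
    finally have eq: "x + s *\<^sub>R v + e *\<^sub>R (x + t *\<^sub>R v + v - (x + s *\<^sub>R v)) = x + t *\<^sub>R v" .
    have "x + s *\<^sub>R v \<in> closure C" using s by (simp add: frontier_def)
    from convex_interior_towards[OF C t(2) this e] have "x + t *\<^sub>R v \<in> interior C" unfolding eq .
    then show False using t(1) by (simp add: frontier_def)
  qed
  show ?thesis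
  proof (rule thin_if_lines_meet_once[OF False])
    fix x s t
    assume "x + s *\<^sub>R v \<in> {x \<in> frontier C. x + v \<in> interior C}"
      and "x + t *\<^sub>R v \<in> {x \<in> frontier C. x + v \<in> interior C}"
    then show "s = t" using one[of x s t] one[of x t s] by force
  qed
qed

section \<open>From thin sets to Haar null sets\<close>

lemma translation_eq_vimage:
  fixes x :: "'a::ab_group_add"
  shows "(\<lambda>e. x + e) ` B = (\<lambda>z. z - x) -` B"
proof (intro equalityI subsetI)
  fix z assume "z \<in> (\<lambda>z. z - x) -` B"
  then have "x + (z - x) \<in> (\<lambda>e. x + e) ` B" by blast
  then show "z \<in> (\<lambda>e. x + e) ` B" by simp
qed auto

lemma translation_borel:
  fixes x :: "'a::real_normed_vector"
  assumes "B \<in> sets borel"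
  shows "(\<lambda>e. x + e) ` B \<in> sets borel"
proof -
  have "(\<lambda>z. z - x) \<in> borel_measurable borel"
    by (intro borel_measurable_continuous_onI continuous_intros)
  from measurable_sets[OF this assms] show ?thesis unfolding translation_eq_vimage by simp
qed

text \<open>
  The measure is the law of a random series of independent finitely supported vectors, the \<open>k\<close>-th of
  norm at most \<open>(1/2) ^ k\<close>. For each pair \<open>(n, m)\<close> one of the summands, number
  \<open>prod_encode (n, m)\<close>, comes from thinness of \<open>A n\<close> with \<open>\<delta> = 1 / Suc m\<close>. Conditioning on all
  other summands bounds the mass of every translate of \<open>A n\<close> by \<open>1 / Suc m\<close>, for every \<open>m\<close>.
\<close>
theorem haar_null_if_covered_by_thin:
  fixes A :: "nat \<Rightarrow> 'a::banach set"
  assumes A: "\<And>n. A n \<in> sets borel" "\<And>n. thin (A n)"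
    and E: "E \<in> sets borel" "E \<subseteq> (\<Union>n. A n)"
  shows "haar_null E"
proof -
  have "\<exists>p. finite (set_pmf p) \<and> set_pmf p \<subseteq> cball 0 ((1/2) ^ k) \<and>
      (\<forall>x. measure_pmf.prob p {y. x + y \<in> A (fst (prod_decode k))} \<le> 1 / real (Suc (snd (prod_decode k))))" for k
  proof -
    have "0 < (1/2::real) ^ k" "0 < 1 / real (Suc (snd (prod_decode k)))" by simp_all
    then show ?thesis using A(2)[of "fst (prod_decode k)"] unfolding thin_def by blast
  qed
  then obtain p where fin: "\<And>k. finite (set_pmf (p k))" and small: "\<And>k. set_pmf (p k) \<subseteq> cball 0 ((1/2) ^ k)"
    and thin: "\<And>k x. measure_pmf.prob (p k) {y. x + y \<in> A (fst (prod_decode k))} \<le> 1 / real (Suc (snd (prod_decode k)))"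
    by metis
  \<comment> \<open>off the support \<open>h k\<close> vanishes, so it has finite range and the series converges everywhere\<close>
  define h where "h k y = (if y \<in> set_pmf (p k) then y else 0)" for k y
  have h0: "h k 0 = 0" for k unfolding h_def by simp
  have hle: "norm (h k y) \<le> (1/2) ^ k" for k y using small[of k] unfolding h_def by auto
  have hfin: "finite (range (h k))" for k
    by (rule finite_subset[of _ "insert 0 (set_pmf (p k))"]) (auto simp: h_def fin)
  define M where "M = PiM UNIV (\<lambda>k. measure_pmf (p k))"
  interpret M: prob_space M unfolding M_def by (intro prob_space_PiM measure_pmf.prob_space_axioms)
  define S where "S \<omega> = (\<Sum>k. h k (\<omega> k))" for \<omega>
  have summ: "summable (\<lambda>k. h k (\<omega> k))" for \<omega>
    by (rule summable_comparison_test'[where g = "\<lambda>k. (1/2) ^ k" and N = 0]) (auto simp: hle summable_geometric)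
  \<comment> \<open>partial sums are simple functions, hence measurable without a countable base of the topology\<close>
  have simple: "simple_function M (\<lambda>\<omega>. h k (\<omega> k))" for k
  proof -
    have "(\<lambda>\<omega>. \<omega> k) \<in> measurable M (measure_pmf (p k))"
      unfolding M_def by (rule measurable_component_singleton) simp
    then have "(\<lambda>\<omega>. \<omega> k) -` X \<inter> space M \<in> sets M" for X by (rule measurable_sets) simp
    then have "(\<lambda>\<omega>. h k (\<omega> k)) -` {z} \<inter> space M \<in> sets M" for z
    proof -
      have "(\<lambda>\<omega>. h k (\<omega> k)) -` {z} \<inter> space M = (\<lambda>\<omega>. \<omega> k) -` (h k -` {z}) \<inter> space M" by auto
      then show ?thesis using \<open>\<And>X. (\<lambda>\<omega>. \<omega> k) -` X \<inter> space M \<in> sets M\<close> by simp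
    qed
    moreover have "finite ((\<lambda>\<omega>. h k (\<omega> k)) ` space M)" by (rule finite_subset[OF _ hfin[of k]]) auto
    ultimately show ?thesis unfolding simple_function_def by blast
  qed
  have meas: "S \<in> borel_measurable M"
  proof (rule borel_measurable_LIMSEQ_metric)
    show "(\<lambda>\<omega>. \<Sum>k<n. h k (\<omega> k)) \<in> borel_measurable M" for n
      by (intro borel_measurable_simple_function simple_function_sum simple)
    show "(\<lambda>n. \<Sum>k<n. h k (\<omega> k)) \<longlonglongrightarrow> S \<omega>" for \<omega>
      unfolding S_def by (rule summable_LIMSEQ[OF summ])
  qed
  \<comment> \<open>replacing the coordinate \<open>k\<close> by \<open>0\<close> isolates the contribution of its summand\<close>
  have upd: "S (fun_upd \<omega> k y) = S (fun_upd \<omega> k 0) + h k y" for \<omega> k y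
  proof -
    have "(\<lambda>j. h j (fun_upd \<omega> k y j) - h j (fun_upd \<omega> k 0 j)) sums (S (fun_upd \<omega> k y) - S (fun_upd \<omega> k 0))"
      unfolding S_def by (intro sums_diff summable_sums summ)
    moreover have "(\<lambda>j. h j (fun_upd \<omega> k y j) - h j (fun_upd \<omega> k 0 j)) = (\<lambda>j. if j = k then h k y else 0)"
      by (auto simp: h0)
    moreover have "(\<lambda>j. if j = k then h k y else 0) sums h k y" by (rule sums_single)
    ultimately have "S (fun_upd \<omega> k y) - S (fun_upd \<omega> k 0) = h k y" by (simp add: sums_unique2)
    then show ?thesis by (simp add: algebra_simps)
  qed
  let ?\<mu> = "distr M borel S"
  have bound: "emeasure ?\<mu> ((\<lambda>e. x + e) ` A n) \<le> ennreal (1 / real (Suc m))" for x n m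
  proof -
    let ?B = "(\<lambda>e. x + e) ` A n"
    define k where "k = prod_encode (n, m)"
    \<comment> \<open>resampling coordinate \<open>k\<close> independently preserves the product measure\<close>
    let ?N = "measure_pmf (p k) \<Otimes>\<^sub>M M"
    let ?u = "\<lambda>w. fun_upd (snd w) k (fst w)"
    interpret pair_sigma_finite "measure_pmf (p k)" M
      by (intro pair_sigma_finite.intro measure_pmf.sigma_finite_measure_axioms M.sigma_finite_measure_axioms)
    have dM: "distr ?N M ?u = M"
      using distr_pair_PiM_eq_PiM[of UNIV "\<lambda>k. measure_pmf (p k)" k]
      unfolding M_def by (simp add: measure_pmf.prob_space_axioms insert_absorb case_prod_unfold)
    have u: "?u \<in> measurable ?N M"
      unfolding M_def
      by (rule measurable_fun_upd[where J = UNIV]) (auto intro: measurable_fst measurable_snd)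
    have Bb: "?B \<in> sets borel" using translation_borel A(1) by blast
    have f: "(\<lambda>\<omega>. indicator ?B (S \<omega>) :: ennreal) \<in> borel_measurable M"
      using meas Bb by measurable
    have "emeasure ?\<mu> ?B = (\<integral>\<^sup>+ z. indicator ?B z \<partial>?\<mu>)" using Bb by simp
    also have "\<dots> = (\<integral>\<^sup>+ \<omega>. indicator ?B (S \<omega>) \<partial>M)"
      using meas Bb by (intro nn_integral_distr) auto
    also have "\<dots> = (\<integral>\<^sup>+ \<omega>. indicator ?B (S \<omega>) \<partial>distr ?N M ?u)" unfolding dM ..
    also have "\<dots> = (\<integral>\<^sup>+ w. indicator ?B (S (?u w)) \<partial>?N)" by (rule nn_integral_distr[OF u]) (use f in simp)
    also have "\<dots> = (\<integral>\<^sup>+ \<omega>. (\<integral>\<^sup>+ y. indicator ?B (S (?u (y, \<omega>))) \<partial>measure_pmf (p k)) \<partial>M)"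
      by (rule nn_integral_snd[symmetric]) (rule measurable_compose[OF u f])
    also have "\<dots> \<le> (\<integral>\<^sup>+ \<omega>. ennreal (1 / real (Suc m)) \<partial>M)"
    proof (rule nn_integral_mono)
      fix \<omega>
      let ?D = "{y. (S (fun_upd \<omega> k 0) - x) + y \<in> A n}"
      have "(\<integral>\<^sup>+ y. indicator ?B (S (?u (y, \<omega>))) \<partial>measure_pmf (p k)) = (\<integral>\<^sup>+ y. indicator ?D y \<partial>measure_pmf (p k))"
      proof (intro nn_integral_cong_AE AE_pmfI)
        fix y assume "y \<in> set_pmf (p k)"
        then have "S (?u (y, \<omega>)) - x = S (fun_upd \<omega> k 0) - x + y"
          by (simp add: upd[of \<omega> k y] h_def)
        then have "S (?u (y, \<omega>)) \<in> ?B \<longleftrightarrow> y \<in> ?D" unfolding translation_eq_vimage vimage_eq by (simp only: mem_Collect_eq)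
        then show "indicator ?B (S (?u (y, \<omega>))) = indicator ?D y" by (simp only: indicator_def)
      qed
      also have "\<dots> = ennreal (measure_pmf.prob (p k) ?D)"
        by (simp add: measure_pmf.emeasure_eq_measure)
      also have "\<dots> \<le> ennreal (1 / real (Suc m))"
        using thin[of k "S (fun_upd \<omega> k 0) - x"] unfolding k_def by (intro ennreal_leI) simp
      finally show "(\<integral>\<^sup>+ y. indicator ?B (S (?u (y, \<omega>))) \<partial>measure_pmf (p k)) \<le> ennreal (1 / real (Suc m))" .
    qed
    also have "\<dots> = ennreal (1 / real (Suc m))" by (simp add: M.emeasure_space_1)
    finally show ?thesis .
  qed
  have null: "(\<lambda>e. x + e) ` A n \<in> null_sets ?\<mu>" for x n
  proof -
    have "emeasure ?\<mu> ((\<lambda>e. x + e) ` A n) \<le> 0"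
    proof (rule LIMSEQ_le_const)
      have "(\<lambda>m. ennreal (1 / real (Suc m))) \<longlonglongrightarrow> ennreal 0"
        by (intro tendsto_ennrealI LIMSEQ_Suc lim_1_over_n)
      then show "(\<lambda>m. ennreal (1 / real (Suc m))) \<longlonglongrightarrow> 0" by simp
    qed (use bound in blast)
    then show ?thesis using translation_borel[OF A(1)] by (simp add: null_sets_def)
  qed
  have "emeasure ?\<mu> ((\<lambda>e. x + e) ` E) = 0" for x
  proof -
    have UN: "(\<Union>n. (\<lambda>e. x + e) ` A n) \<in> null_sets ?\<mu>" using null by (rule null_sets_UN)
    have "(\<lambda>e. x + e) ` E \<in> sets ?\<mu>" using translation_borel[OF E(1)] by simp
    moreover have "(\<lambda>e. x + e) ` E \<subseteq> (\<Union>n. (\<lambda>e. x + e) ` A n)" using E(2) by blast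
    ultimately have "(\<lambda>e. x + e) ` E \<in> null_sets ?\<mu>" by (rule null_sets_subset[OF UN])
    then show ?thesis by (rule null_setsD1)
  qed
  moreover have "prob_space ?\<mu>" by (rule M.prob_space_distr[OF meas])
  ultimately show ?thesis unfolding haar_null_def using E(1) by (intro conjI exI[of _ ?\<mu>]) auto
qed

lemma haar_null_if_countably_covered:
  fixes E :: "'a::banach set"
  assumes \<A>: "countable \<A>" "\<And>A. A \<in> \<A> \<Longrightarrow> A \<in> sets borel \<and> thin A"
    and E: "E \<in> sets borel" "E \<subseteq> \<Union>\<A>"
  shows "haar_null E"
proof (rule haar_null_if_covered_by_thin[OF _ _ E(1)])
  let ?A = "from_nat_into (insert {} \<A>)"
  have "?A n \<in> insert {} \<A>" for n by (rule from_nat_into) simp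
  then show "?A n \<in> sets borel" "thin (?A n)" for n using \<A>(2) thin_empty by (metis insertE sets.empty_sets)+
  have "range ?A = insert {} \<A>" using \<A>(1) by (intro range_from_nat_into) auto
  then show "E \<subseteq> (\<Union>n. ?A n)" using E(2) by auto
qed

text \<open>
  Countably many translates of a ball cover a separable space, so a ball cannot have all its
  translates null for a probability measure.
\<close>
lemma haar_null_imp_interior_empty:
  fixes E :: "'a::real_normed_vector set"
  assumes dense: "\<And>x :: 'a. \<And>r. 0 < r \<Longrightarrow> \<exists>n :: nat. norm (x - d n) \<le> r"
    and E: "haar_null E"
  shows "interior E = {}"
proof (rule ccontr)
  assume "interior E \<noteq> {}"
  then obtain x r where r: "0 < r" "ball x r \<subseteq> E"
    by (meson all_not_in_conv mem_interior)
  obtain \<mu> :: "'a measure" where \<mu>: "prob_space \<mu>" "sets \<mu> = sets borel"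
    and null: "\<And>x. emeasure \<mu> ((\<lambda>e. x + e) ` E) = 0" and Eb: "E \<in> sets borel"
    using E unfolding haar_null_def by blast
  interpret prob_space \<mu> by (rule \<mu>(1))
  let ?T = "\<lambda>n. (\<lambda>e. (d n - x) + e) ` E"
  have "z \<in> (\<Union>n. ?T n)" for z
  proof -
    obtain n where "norm (z - d n) \<le> r / 2" using dense[of "r / 2" z] r by auto
    then have "dist x (z - (d n - x)) < r"
      using r by (simp add: dist_norm norm_minus_commute algebra_simps)
    then have "z - (d n - x) \<in> E" using r(2) by auto
    then have "z \<in> ?T n" unfolding translation_eq_vimage by simp
    then show ?thesis by blast
  qed
  then have "(\<Union>n. ?T n) = space \<mu>" using sets_eq_imp_space_eq[OF \<mu>(2)] by auto
  moreover have "(\<Union>n. ?T n) \<in> null_sets \<mu>"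
    using null translation_borel[OF Eb] \<mu>(2) by (intro null_sets_UN) (simp add: null_sets_def)
  ultimately show False using emeasure_space_1 by (simp add: null_sets_def)
qed

section \<open>Discontinuities of quasiconvex functions\<close>

lemma quasiconvex_sublevel:
  fixes f :: "'a::real_vector \<Rightarrow> real"
  assumes f: "quasiconvex f"
  shows "convex {x. f x < b}" "convex {x. f x \<le> b}"
proof -
  have f: "f (u *\<^sub>R x + v *\<^sub>R y) \<le> max (f x) (f y)" if "0 \<le> u" "0 \<le> v" "u + v = 1" for u v x y
  proof -
    have "v = 1 - u" "u \<in> {0..1}" using that by auto
    then show ?thesis using f unfolding quasiconvex_def by blast
  qed
  show "convex {x. f x < b}"
  proof (rule convexI, unfold mem_Collect_eq)
    fix x y :: 'a and u v :: real assume "f x < b" "f y < b" "0 \<le> u" "0 \<le> v" "u + v = 1"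
    then show "f (u *\<^sub>R x + v *\<^sub>R y) < b" using f[of u v x y] by linarith
  qed
  show "convex {x. f x \<le> b}"
  proof (rule convexI, unfold mem_Collect_eq)
    fix x y :: 'a and u v :: real assume "f x \<le> b" "f y \<le> b" "0 \<le> u" "0 \<le> v" "u + v = 1"
    then show "f (u *\<^sub>R x + v *\<^sub>R y) \<le> b" using f[of u v x y] by linarith
  qed
qed

text \<open>
  Some continuity point \<open>y\<close> lies in the interior of the closure; continuity forces \<open>f y \<le> a\<close>, and then
  \<open>f\<close> stays below \<open>b\<close> near \<open>y\<close>.
\<close>
lemma densely_continuous_sublevel:
  fixes f :: "'a::real_normed_vector \<Rightarrow> real"
  assumes f: "densely_continuous f" and ne: "interior (closure {x. f x \<le> a}) \<noteq> {}" and ab: "a < b"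
  shows "interior {x. f x < b} \<noteq> {}"
proof -
  obtain D where D: "closure D = UNIV" "\<And>x. x \<in> D \<Longrightarrow> isCont f x"
    using f unfolding densely_continuous_def by blast
  obtain y where y: "y \<in> D" "y \<in> interior (closure {x. f x \<le> a})"
    using D(1) ne open_interior open_Int_closure_eq_empty[of "interior (closure {x. f x \<le> a})" D] by auto
  have lim: "(f \<longlongrightarrow> f y) (nhds y)" using D(2)[OF y(1)] isCont_def tendsto_at_iff_tendsto_nhds by blast
  have "f y \<le> a"
  proof (rule ccontr)
    assume "\<not> f y \<le> a"
    then have "\<forall>\<^sub>F x in nhds y. a < f x" using order_tendstoD(1)[OF lim] by simp
    then obtain U where U: "open U" "y \<in> U" "\<And>x. x \<in> U \<Longrightarrow> a < f x" unfolding eventually_nhds by blast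
    moreover have "y \<in> closure {x. f x \<le> a}" using y(2) interior_subset by blast
    ultimately obtain x where "x \<in> U" "f x \<le> a"
      using open_Int_closure_eq_empty[of U "{x. f x \<le> a}"] by blast
    then show False using U(3) by force
  qed
  then have "\<forall>\<^sub>F x in nhds y. f x < b" using order_tendstoD(2)[OF lim] ab by simp
  then show ?thesis unfolding eventually_nhds interior_def by blast
qed

text \<open>
  A failure of semicontinuity at \<open>x\<close>, from above or from below, leaves room for rationals \<open>q < r\<close>
  such that \<open>x\<close> is in the closure of \<open>{f \<le> q}\<close> and on the boundary of \<open>{f < r}\<close>. Two levels are needed:
  if the closure of \<open>{f \<le> q}\<close> has interior, dense continuity provides interior only for sublevel sets
  strictly above \<open>q\<close>.
\<close>
lemma discontinuity_near_sublevels: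
  fixes f :: "'a::real_normed_vector \<Rightarrow> real"
  assumes f: "densely_continuous f" and x: "\<not> isCont f x"
  obtains q where "q \<in> \<rat>" "interior (closure {z. f z \<le> q}) = {}" "x \<in> closure {z. f z \<le> q}"
    | q where "q \<in> \<rat>" "interior {z. f z < q} \<noteq> {}" "x \<in> frontier {z. f z < q}"
proof -
  have "\<not> (f \<longlongrightarrow> f x) (at x)" using x by (simp add: isCont_def)
  then consider b where "f x < b" "\<not> (\<forall>\<^sub>F z in at x. f z < b)"
    | a where "a < f x" "\<not> (\<forall>\<^sub>F z in at x. a < f z)"
    unfolding order_tendsto_iff by blast
  then have "\<exists>q r. q \<in> \<rat> \<and> r \<in> \<rat> \<and> q < r \<and> x \<in> closure {z. f z \<le> q} \<and> x \<in> frontier {z. f z < r}"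
  proof cases
    case 1
    obtain r where r: "r \<in> \<rat>" "f x < r" "r < b" using Rats_dense_in_real[OF 1(1)] by blast
    obtain q where q: "q \<in> \<rat>" "f x < q" "q < r" using Rats_dense_in_real[OF r(2)] by blast
    have "x \<in> closure {z. f z \<le> q}" using q by (intro closure_subset[THEN subsetD]) simp
    moreover have "x \<notin> interior {z. f z < r}"
    proof
      assume "x \<in> interior {z. f z < r}"
      then have "\<forall>\<^sub>F z in at x. z \<in> interior {z. f z < r}" by (intro eventually_at_in_open') auto
      then have "\<forall>\<^sub>F z in at x. f z < b"
        by (rule eventually_mono) (use r interior_subset in fastforce)
      then show False using 1(2) by blast
    qed
    moreover have "x \<in> closure {z. f z < r}" using r by (intro closure_subset[THEN subsetD]) simp
    ultimately show ?thesis using q r unfolding frontier_def by blast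
  next
    case 2
    obtain r where r: "r \<in> \<rat>" "a < r" "r < f x" using Rats_dense_in_real[OF 2(1)] by blast
    obtain q where q: "q \<in> \<rat>" "a < q" "q < r" using Rats_dense_in_real[OF r(2)] by blast
    have cl: "x \<in> closure {z. f z \<le> q}"
    proof (rule ccontr)
      assume "x \<notin> closure {z. f z \<le> q}"
      then have "\<forall>\<^sub>F z in at x. z \<in> - closure {z. f z \<le> q}" by (intro eventually_at_in_open') auto
      then have "\<forall>\<^sub>F z in at x. a < f z"
      proof (rule eventually_mono)
        fix z assume "z \<in> - closure {z. f z \<le> q}"
        then have "z \<notin> {z. f z \<le> q}" using closure_subset[of "{z. f z \<le> q}"] by blast
        then show "a < f z" using q by simp
      qed
      then show False using 2(2) by blast
    qed
    have "closure {z. f z \<le> q} \<subseteq> closure {z. f z < r}" using q by (intro closure_mono) auto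
    moreover have "x \<notin> interior {z. f z < r}" using r interior_subset by fastforce
    ultimately show ?thesis using cl q r unfolding frontier_def by blast
  qed
  then obtain q r where "q \<in> \<rat>" "r \<in> \<rat>" "q < r" "x \<in> closure {z. f z \<le> q}" "x \<in> frontier {z. f z < r}"
    by blast
  then show thesis using that densely_continuous_sublevel[OF f, of q r] by blast
qed

theorem theorem3p3:
  fixes f :: "'a::banach \<Rightarrow> real"
  assumes "reflexive_space TYPE('a)"
    and "separable_space (euclidean :: 'a topology)"
    and "quasiconvex f"
  shows "densely_continuous f \<longleftrightarrow> haar_null {x. \<not> isCont f x}"
proof -
  obtain Q :: "'a set" where Q: "countable Q" "closure Q = UNIV"
    using assms(2) unfolding separable_space_def by auto
  define d where "d = from_nat_into Q"
  have "Q \<noteq> {}" using Q(2) by auto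
  then have d: "range d = Q" unfolding d_def using Q(1) by (rule range_from_nat_into)
  have dense: "\<exists>n. norm (x - d n) \<le> r" if r: "0 < r" for x :: 'a and r
  proof -
    have "x \<in> closure (range d)" using d Q(2) by simp
    then obtain n where "dist (d n) x < r" using r unfolding closure_approachable by blast
    then show ?thesis by (auto simp: dist_norm norm_minus_commute intro: less_imp_le)
  qed
  have Db: "{x. \<not> isCont f x} \<in> sets borel" by measurable
  show ?thesis
  proof
    assume null: "haar_null {x. \<not> isCont f x}"
    have "closure {x. isCont f x} = - interior {x. \<not> isCont f x}"
      by (simp add: closure_interior Collect_neg_eq)
    then have "closure {x. isCont f x} = UNIV" using haar_null_imp_interior_empty[OF dense null] by simp
    then show "densely_continuous f" unfolding densely_continuous_def by blast
  next
    assume f: "densely_continuous f"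
    \<comment> \<open>\<open>F q n\<close> is the part of a boundary seen along \<open>d n\<close>; \<open>G q n\<close> cuts a closed sublevel set to a bounded one\<close>
    define F where "F q n = {x \<in> frontier {z. f z < q}. x + d n \<in> interior {z. f z < q}}" for q n
    define G where "G q n = closure {z. f z \<le> q} \<inter> cball 0 (real n)" for q n
    let ?\<A> = "(\<lambda>(q, n). F q n) ` (\<rat> \<times> UNIV) \<union>
      (\<lambda>(q, n). G q n) ` ({q \<in> \<rat>. interior (closure {z. f z \<le> q}) = {}} \<times> UNIV)"
    show "haar_null {x. \<not> isCont f x}"
    proof (rule haar_null_if_countably_covered[OF _ _ Db])
      have "countable {q \<in> \<rat>. interior (closure {z. f z \<le> q}) = {}}"
        using countable_rat by (rule countable_subset[rotated]) auto
      then show "countable ?\<A>" using countable_rat by (intro countable_Un countable_image countable_SIGMA) auto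
    next
      fix A assume "A \<in> ?\<A>"
      then consider q n where "A = F q n" | q n where "A = G q n" "interior (closure {z. f z \<le> q}) = {}"
        by auto
      then show "A \<in> sets borel \<and> thin A"
      proof cases
        case 1
        have "A = frontier {z. f z < q} \<inter> (\<lambda>x. x + d n) -` interior {z. f z < q}"
          unfolding 1 F_def by auto
        moreover have "open ((\<lambda>x. x + d n) -` interior {z. f z < q})"
          by (intro open_vimage continuous_intros) auto
        ultimately have "A \<in> sets borel" by simp
        then show ?thesis using thin_frontier_seen_along[OF quasiconvex_sublevel(1)[OF assms(3)]]
          unfolding 1 F_def by blast
      next
        case 2
        have "thin A" unfolding 2(1) G_def
        proof (rule thin_bounded_convex_empty_interior[OF assms(1) dense])
          show "convex (closure {z. f z \<le> q} \<inter> cball 0 (real n))"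
            by (intro convex_Int convex_closure quasiconvex_sublevel(2)[OF assms(3)] convex_cball)
          show "bounded (closure {z. f z \<le> q} \<inter> cball 0 (real n))" by (simp add: bounded_Int)
          show "interior (closure {z. f z \<le> q} \<inter> cball 0 (real n)) = {}" using 2(2) by simp
        qed auto
        then show ?thesis unfolding 2(1) G_def by simp
      qed
    next
      show "{x. \<not> isCont f x} \<subseteq> \<Union>?\<A>"
      proof
        fix x assume "x \<in> {x. \<not> isCont f x}"
        then have "\<not> isCont f x" by simp
        with f show "x \<in> \<Union>?\<A>"
        proof (cases rule: discontinuity_near_sublevels)
          case (1 q)
          obtain n where "norm x \<le> real n" using real_arch_simple by blast
          then have "x \<in> G q n" unfolding G_def using 1 by simp
          then show ?thesis using 1 by blast
        next
          case (2 q)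
          obtain y where "y \<in> interior {z. f z < q}" using 2 by blast
          then obtain e where e: "0 < e" "cball y e \<subseteq> interior {z. f z < q}"
            using open_contains_cball[of "interior {z. f z < q}"] by auto
          obtain n where "norm (y - x - d n) \<le> e" using dense[OF e(1)] by blast
          then have "x + d n \<in> cball y e" by (simp add: dist_norm algebra_simps)
          then have "x \<in> F q n" unfolding F_def using 2 e by auto
          then show ?thesis using 2 by blast
        qed
      qed
    qed
  qed
qed

end
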